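(* The calculus $\mathsf{QG}^{\mathrm{qp}}_\uparrow$ is complete for $\mathbf{G}^{\mathrm{qp}}_\uparrow$: every formula that is a tautology over the truth-value set $V_\uparrow=\{1-1/n:n\ge1\}\cup\{1\}$ is derivable in $\mathsf{QG}^{\mathrm{qp}}_\uparrow$.
   Context: Formulas are built from a countably infinite set $\mathrm{Var}$ of propositional variables and the constants $\bot,\top$ using $\land,\lor,\supset$, the unary connective $\circ$, and the propositional quantifiers $(\forall p)$, $(\exists p)$. Abbreviations: $\neg A:=A\supset\bot$; $A\leftrightarrow B:=(A\supset B)\land(B\supset A)$; $A\prec B:=(A\supset B)\land((B\supset A)\supset A)$. $A(X)$ is the result of substituting $X$ for the free occurrences of $p$ in $A(p)$ (without variable capture). Semantics over $V_\uparrow$: a valuation is a map $v:\mathrm{Var}\to V_\uparrow$; $v[w/p]$ agrees with $v$ except that it maps $p$ to $w$. $v(\bot)=0$, $v(\top)=1$, $v(A\land B)=\min(v(A),v(B))$, $v(A\lor B)=\max(v(A),v(B))$, $v(A\supset B)=1$ if $v(A)\le v(B)$ and $=v(B)$ otherwise, $v((\exists p)A)=\sup\{v[w/p](A):w\in V_\uparrow\}$, $v((\forall p)A)=\inf\{v[w/p](A):w\in V_\uparrow\}$, and $v(\circ A)=v((\forall p)((p\supset A)\lor p))$ with $p$ not free in $A$, i.e. $v(\circ A)=1$ if $v(A)=1$ and $v(\circ A)=1-\frac1{n+1}$ if $v(A)=1-\frac1n$. $A$ is a tautology over $V_\uparrow$ if $v(A)=1$ for all valuations $v$; $\mathbf{G}^{\mathrm{qp}}_\uparrow$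 is the set of these tautologies. The Hilbert system $\mathsf{QG}^{\mathrm{qp}}_\uparrow$ has the axiom schemes: (I1) $A\supset(B\supset A)$; (I2) $(A\land B)\supset A$; (I3) $(A\land B)\supset B$; (I4) $A\supset(B\supset(A\land B))$; (I5) $A\supset(A\lor B)$; (I6) $B\supset(A\lor B)$; (I7) $(A\land\neg A)\supset B$; (I8) $(A\supset\neg A)\supset\neg A$; (I9) $\bot\supset A$; (I10) $A\supset\top$; (I11) $(A\supset(B\supset C))\supset((A\supset B)\supset(A\supset C))$; (I12) $((A\supset C)\land(B\supset C))\supset((A\lor B)\supset C)$; (LC) $(A\supset B)\lor(B\supset A)$; $A(C)\supset(\exists p)A(p)$; $(\forall p)A(p)\supset A(C)$; $(\forall p)[A\lor B(p)]\supset[A\lor(\forall p)B(p)]$ with $p$ not free in $A$; (G1) $\circ(A\supset B)\leftrightarrow(\circ A\supset\circ B)$; (G2) $A\prec\circ A$; (G3) $(\circ A\supset\circ B)\supset((A\supset B)\lor\circ B)$; (G4) $(A\supset\circ B)\supset((A\supset C)\lor(C\supset B))$; (G5) $(A\leftrightarrow\bot)\lor(\exists p)(A\leftrightarrow\circ p)$, $p$ not free in $A$; (G6) $(A\prec B)\supset(\circ A\supset B)$. Rules: modus ponens; from $A(p)\supset B$ infer $(\exists p)A(p)\supset B$, and from $B\supset A(p)$ infer $B\supset(\forall p)A(p)$, where $p$ is not free in $B$. *)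

theory Defs
  imports Complex_Main
begin

type_synonym var = nat

datatype fm =
    Atom var
  | Bot
  | Top
  | And fm fm  (infixr "\<^bold>\<and>" 35)
  | Or fm fm   (infixr "\<^bold>\<or>" 30)
  | Imp fm fm  (infixr "\<^bold>\<supset>" 25)
  | Circ fm
  | Forall var fm
  | Exists var fm

abbreviation Neg :: "fm \<Rightarrow> fm"
  where "Neg A \<equiv> A \<^bold>\<supset> Bot"

abbreviation Iff :: "fm \<Rightarrow> fm \<Rightarrow> fm"  (infix "\<^bold>\<leftrightarrow>" 25)
  where "A \<^bold>\<leftrightarrow> B \<equiv> (A \<^bold>\<supset> B) \<^bold>\<and> (B \<^bold>\<supset> A)"

abbreviation Prec :: "fm \<Rightarrow> fm \<Rightarrow> fm"  (infix "\<^bold>\<prec>" 25)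
  where "A \<^bold>\<prec> B \<equiv> (A \<^bold>\<supset> B) \<^bold>\<and> ((B \<^bold>\<supset> A) \<^bold>\<supset> A)"

primrec fv :: "fm \<Rightarrow> var set" where
  "fv (Atom q) = {q}"
| "fv Bot = {}"
| "fv Top = {}"
| "fv (A \<^bold>\<and> B) = fv A \<union> fv B"
| "fv (A \<^bold>\<or> B) = fv A \<union> fv B"
| "fv (A \<^bold>\<supset> B) = fv A \<union> fv B"
| "fv (Circ A) = fv A"
| "fv (Forall q A) = fv A - {q}"
| "fv (Exists q A) = fv A - {q}"

text \<open>Textual replacement of the free occurrences of \<open>p\<close> by \<open>X\<close>, with no renaming of bound
  variables; it is only used under the side condition \<open>free_for p X A\<close>, which excludes capture.\<close>

primrec subst :: "var \<Rightarrow> fm \<Rightarrow> fm \<Rightarrow> fm" where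
  "subst p X (Atom q) = (if q = p then X else Atom q)"
| "subst p X Bot = Bot"
| "subst p X Top = Top"
| "subst p X (A \<^bold>\<and> B) = (subst p X A \<^bold>\<and> subst p X B)"
| "subst p X (A \<^bold>\<or> B) = (subst p X A \<^bold>\<or> subst p X B)"
| "subst p X (A \<^bold>\<supset> B) = (subst p X A \<^bold>\<supset> subst p X B)"
| "subst p X (Circ A) = Circ (subst p X A)"
| "subst p X (Forall q A) = (if q = p then Forall q A else Forall q (subst p X A))"
| "subst p X (Exists q A) = (if q = p then Exists q A else Exists q (subst p X A))"

primrec free_for :: "var \<Rightarrow> fm \<Rightarrow> fm \<Rightarrow> bool" where
  "free_for p X (Atom q) \<longleftrightarrow> True"
| "free_for p X Bot \<longleftrightarrow> True"
| "free_for p X Top \<longleftrightarrow> True"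
| "free_for p X (A \<^bold>\<and> B) \<longleftrightarrow> free_for p X A \<and> free_for p X B"
| "free_for p X (A \<^bold>\<or> B) \<longleftrightarrow> free_for p X A \<and> free_for p X B"
| "free_for p X (A \<^bold>\<supset> B) \<longleftrightarrow> free_for p X A \<and> free_for p X B"
| "free_for p X (Circ A) \<longleftrightarrow> free_for p X A"
| "free_for p X (Forall q A) \<longleftrightarrow> p \<notin> fv (Forall q A) \<or> q \<notin> fv X \<and> free_for p X A"
| "free_for p X (Exists q A) \<longleftrightarrow> p \<notin> fv (Exists q A) \<or> q \<notin> fv X \<and> free_for p X A"

definition V_up :: "real set"
  where "V_up = {1 - 1 / real n | n. n \<ge> 1} \<union> {1}"

definition goedel_imp :: "real \<Rightarrow> real \<Rightarrow> real"
  where "goedel_imp a b = (if a \<le> b then 1 else b)"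

text \<open>The clause for \<open>Circ A\<close> is the value of \<open>Forall p ((Atom p \<^bold>\<supset> A) \<^bold>\<or> Atom p)\<close> for \<open>p\<close> not free
  in \<open>A\<close>, unfolded so that the recursion is structural; see \<open>eval_Circ_eq_Forall\<close> and the closed
  forms below it.\<close>

primrec eval :: "(var \<Rightarrow> real) \<Rightarrow> fm \<Rightarrow> real" where
  "eval v (Atom q) = v q"
| "eval v Bot = 0"
| "eval v Top = 1"
| "eval v (A \<^bold>\<and> B) = min (eval v A) (eval v B)"
| "eval v (A \<^bold>\<or> B) = max (eval v A) (eval v B)"
| "eval v (A \<^bold>\<supset> B) = goedel_imp (eval v A) (eval v B)"
| "eval v (Circ A) = (INF w\<in>V_up. max (goedel_imp w (eval v A)) w)"
| "eval v (Forall p A) = (INF w\<in>V_up. eval (v(p := w)) A)"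
| "eval v (Exists p A) = (SUP w\<in>V_up. eval (v(p := w)) A)"

lemma eval_upd_not_free: "p \<notin> fv A \<Longrightarrow> eval (v(p := w)) A = eval v A"
proof (induction A arbitrary: v)
  case (Forall q A)
  have "eval (v(p := w, q := u)) A = eval (v(q := u)) A" for u
  proof (cases "q = p")
    case False
    with Forall.prems have "p \<notin> fv A" by simp
    then show ?thesis
      using Forall.IH[of "v(q := u)"] fun_upd_twist[OF False, of v u w] by metis
  qed simp
  then show ?case by (simp del: fun_upd_apply)
next
  case (Exists q A)
  have "eval (v(p := w, q := u)) A = eval (v(q := u)) A" for u
  proof (cases "q = p")
    case False
    with Exists.prems have "p \<notin> fv A" by simp
    then show ?thesis
      using Exists.IH[of "v(q := u)"] fun_upd_twist[OF False, of v u w] by metis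
  qed simp
  then show ?case by (simp del: fun_upd_apply)
qed auto

lemma eval_Circ_eq_Forall:
  "p \<notin> fv A \<Longrightarrow> eval v (Circ A) = eval v (Forall p ((Atom p \<^bold>\<supset> A) \<^bold>\<or> Atom p))"
  by (simp add: eval_upd_not_free)

lemma V_up_le_1: "w \<in> V_up \<Longrightarrow> w \<le> 1"
  by (auto simp: V_up_def)

lemma eval_Circ_eq_1: "eval v A = 1 \<Longrightarrow> eval v (Circ A) = 1"
proof -
  assume "eval v A = 1"
  then have "max (goedel_imp w (eval v A)) w = 1" if "w \<in> V_up" for w
    using V_up_le_1[OF that] by (simp add: goedel_imp_def)
  moreover have "V_up \<noteq> {}" by (auto simp: V_up_def)
  ultimately show ?thesis by simp
qed

lemma eval_Circ_eq_Suc: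
  assumes "n \<ge> 1" and A: "eval v A = 1 - 1 / real n"
  shows "eval v (Circ A) = 1 - 1 / real (n + 1)"
proof -
  let ?b = "1 - 1 / real (n + 1)"
  let ?f = "\<lambda>w. max (goedel_imp w (eval v A)) w"
  have lt: "1 - 1 / real n < ?b"
    using assms(1) by (simp add: field_simps)
  have mem: "?b \<in> V_up"
    unfolding V_up_def by (rule UnI1, rule CollectI, rule exI[of _ "n + 1"]) simp
  have at: "?f ?b = ?b"
    using lt by (simp add: goedel_imp_def A)
  have low: "?b \<le> ?f w" if "w \<in> V_up" for w
  proof (cases "w \<le> eval v A")
    case True
    then show ?thesis by (simp add: goedel_imp_def le_max_iff_disj)
  next
    case False
    have "?b \<le> w"
    proof (cases "w = 1")
      case False
      with that obtain m where m: "m \<ge> 1" "w = 1 - 1 / real m" by (auto simp: V_up_def)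
      from \<open>\<not> w \<le> eval v A\<close> have "1 / real m < 1 / real n" by (simp add: m(2) A)
      then have "n + 1 \<le> m"
        using m(1) assms(1) by (simp add: field_simps)
      then have "1 / real m \<le> 1 / real (n + 1)"
        by (intro divide_left_mono) auto
      then show ?thesis by (simp add: m(2))
    qed simp
    then show ?thesis by (simp add: le_max_iff_disj)
  qed
  have "Inf (?f ` V_up) = ?b"
  proof (rule cInf_eq_minimum)
    show "?b \<in> ?f ` V_up" using imageI[OF mem, of ?f] unfolding at .
  qed (use low in auto)
  then show ?thesis by simp
qed

definition tautology :: "fm \<Rightarrow> bool"
  where "tautology A \<longleftrightarrow> (\<forall>v. range v \<subseteq> V_up \<longrightarrow> eval v A = 1)"

definition Gqp_up :: "fm set"
  where "Gqp_up = {A. tautology A}"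

inductive QGqp_up :: "fm \<Rightarrow> bool"  ("\<turnstile> _" [20] 20) where
  I1: "\<turnstile> A \<^bold>\<supset> (B \<^bold>\<supset> A)"
| I2: "\<turnstile> (A \<^bold>\<and> B) \<^bold>\<supset> A"
| I3: "\<turnstile> (A \<^bold>\<and> B) \<^bold>\<supset> B"
| I4: "\<turnstile> A \<^bold>\<supset> (B \<^bold>\<supset> (A \<^bold>\<and> B))"
| I5: "\<turnstile> A \<^bold>\<supset> (A \<^bold>\<or> B)"
| I6: "\<turnstile> B \<^bold>\<supset> (A \<^bold>\<or> B)"
| I7: "\<turnstile> (A \<^bold>\<and> Neg A) \<^bold>\<supset> B"
| I8: "\<turnstile> (A \<^bold>\<supset> Neg A) \<^bold>\<supset> Neg A"
| I9: "\<turnstile> Bot \<^bold>\<supset> A"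
| I10: "\<turnstile> A \<^bold>\<supset> Top"
| I11: "\<turnstile> (A \<^bold>\<supset> (B \<^bold>\<supset> C)) \<^bold>\<supset> ((A \<^bold>\<supset> B) \<^bold>\<supset> (A \<^bold>\<supset> C))"
| I12: "\<turnstile> ((A \<^bold>\<supset> C) \<^bold>\<and> (B \<^bold>\<supset> C)) \<^bold>\<supset> ((A \<^bold>\<or> B) \<^bold>\<supset> C)"
| LC: "\<turnstile> (A \<^bold>\<supset> B) \<^bold>\<or> (B \<^bold>\<supset> A)"
| Exists_intro: "free_for p C A \<Longrightarrow> \<turnstile> subst p C A \<^bold>\<supset> Exists p A"
| Forall_elim: "free_for p C A \<Longrightarrow> \<turnstile> Forall p A \<^bold>\<supset> subst p C A"
| Forall_shift: "p \<notin> fv A \<Longrightarrow> \<turnstile> Forall p (A \<^bold>\<or> B) \<^bold>\<supset> (A \<^bold>\<or> Forall p B)"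
| G1: "\<turnstile> Circ (A \<^bold>\<supset> B) \<^bold>\<leftrightarrow> (Circ A \<^bold>\<supset> Circ B)"
| G2: "\<turnstile> A \<^bold>\<prec> Circ A"
| G3: "\<turnstile> (Circ A \<^bold>\<supset> Circ B) \<^bold>\<supset> ((A \<^bold>\<supset> B) \<^bold>\<or> Circ B)"
| G4: "\<turnstile> (A \<^bold>\<supset> Circ B) \<^bold>\<supset> ((A \<^bold>\<supset> C) \<^bold>\<or> (C \<^bold>\<supset> B))"
| G5: "p \<notin> fv A \<Longrightarrow> \<turnstile> (A \<^bold>\<leftrightarrow> Bot) \<^bold>\<or> Exists p (A \<^bold>\<leftrightarrow> Circ (Atom p))"
| G6: "\<turnstile> (A \<^bold>\<prec> B) \<^bold>\<supset> (Circ A \<^bold>\<supset> B)"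
| MP: "\<turnstile> A \<Longrightarrow> \<turnstile> A \<^bold>\<supset> B \<Longrightarrow> \<turnstile> B"
| Exists_rule: "\<turnstile> A \<^bold>\<supset> B \<Longrightarrow> p \<notin> fv B \<Longrightarrow> \<turnstile> Exists p A \<^bold>\<supset> B"
| Forall_rule: "\<turnstile> B \<^bold>\<supset> A \<Longrightarrow> p \<notin> fv B \<Longrightarrow> \<turnstile> B \<^bold>\<supset> Forall p A"

end

theory Submission
  imports Defs "HOL-Library.Extended_Nat"
begin

text \<open>An underivable formula \<open>A\<close> is kept out of some prime Henkin theory \<open>T\<close>. Derivability of
  \<open>B \<^bold>\<supset> C\<close> from \<open>T\<close> orders the formulas as a chain in which \<open>Circ\<close> is the successor
  function and, by (G5), every element above \<open>Bot\<close> is a successor; the quantifiers are infima and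
  suprema in this chain. Whether the value of a formula exceeds a non-top element \<open>y\<close> depends only
  on the chain up to \<open>y\<close>, and an Ehrenfeucht-Fraisse game on distances shows that, for formulas of
  bounded depth, this part of the chain can be replaced by a finite initial segment of the natural
  numbers. The resulting valuation in \<open>V_up\<close> refutes \<open>A\<close>; no quantifier elimination is
  needed.\<close>

section \<open>Forcing over a chain\<close>

text \<open>Nothing forces the formulas modulo a Henkin theory to embed into \<open>V_up\<close>:
  there may be elements above all iterated successors of \<open>Bot\<close>, and an embedding would
  have to respect infima and suprema. One formula sees only finitely much of the chain, so a single
  refutation is transferred instead of the chain. Recording a value by the worlds strictly below it
  makes both quantifiers pointwise. For infima this relies on discreteness: values strictly above
  \<open>y\<close> are all at least the successor of \<open>y\<close>, so their infimum stays
  strictly above \<open>y\<close>. A second obstacle is impredicativity: an instance by an arbitrary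
  formula is not simpler than the quantified formula. In a Henkin theory every formula is equivalent
  to a variable, so instances by variables suffice and induction on size goes through.\<close>

text \<open>\<open>forces le f y A\<close> says that the value of \<open>A\<close> under \<open>f\<close> is strictly above \<open>y\<close>; this reading is
  correct only for \<open>y\<close> below the top element.\<close>

primrec forces :: "('a \<Rightarrow> 'a \<Rightarrow> bool) \<Rightarrow> (var \<Rightarrow> 'a) \<Rightarrow> 'a \<Rightarrow> fm \<Rightarrow> bool" where
  "forces le f y (Atom p) \<longleftrightarrow> \<not> le (f p) y"
| "forces le f y Bot \<longleftrightarrow> False"
| "forces le f y Top \<longleftrightarrow> True"
| "forces le f y (A \<^bold>\<and> B) \<longleftrightarrow> forces le f y A \<and> forces le f y B"
| "forces le f y (A \<^bold>\<or> B) \<longleftrightarrow> forces le f y A \<or> forces le f y B"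
| "forces le f y (A \<^bold>\<supset> B) \<longleftrightarrow> (\<forall>z. le z y \<longrightarrow> forces le f z A \<longrightarrow> forces le f z B)"
| "forces le f y (Circ A) \<longleftrightarrow> (\<forall>z. le z y \<and> \<not> le y z \<longrightarrow> forces le f z A)"
| "forces le f y (Forall p A) \<longleftrightarrow> (\<forall>c. forces le (f(p := c)) y A)"
| "forces le f y (Exists p A) \<longleftrightarrow> (\<exists>c. forces le (f(p := c)) y A)"

text \<open>Only a preorder, because formulas are not quotiented by equivalence; equality appears as
  two inequalities. By \<open>suc_top\<close> only a greatest element can lie above its own
  successor, so chains with a top are covered as well.\<close>

locale discrete_chain =
  fixes le :: "'a \<Rightarrow> 'a \<Rightarrow> bool" and s :: "'a \<Rightarrow> 'a" and z :: 'a
  assumes refl: "le a a"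
    and trans: "le a b \<Longrightarrow> le b c \<Longrightarrow> le a c"
    and zero_least: "le z a"
    and le_suc: "le a (s a)"
    and suc_le: "\<not> le b a \<Longrightarrow> le (s a) b"
    and suc_top: "le (s a) a \<Longrightarrow> le b a"
    and pred: "le a z \<or> (\<exists>q. le (s q) a \<and> le a (s q))"
begin

lemma total: "le a b \<or> le b a"
  using suc_le trans le_suc by blast

lemma suc_mono: "le a b \<Longrightarrow> le (s a) (s b)"
  by (meson le_suc suc_le suc_top trans)

section \<open>Iterated successors and distances\<close>

lemma pow_mono: "le a b \<Longrightarrow> le ((s ^^ j) a) ((s ^^ j) b)"
  by (induction j) (auto intro: suc_mono)

lemma pow_add: "(s ^^ (i + j)) a = (s ^^ i) ((s ^^ j) a)"
  by (simp add: funpow_add)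

lemma le_pow: "le a ((s ^^ j) a)"
  by (induction j) (auto intro: refl trans le_suc)

lemma pow_mono_exp: "i \<le> j \<Longrightarrow> le ((s ^^ i) a) ((s ^^ j) a)"
  using le_pow[of "(s ^^ i) a" "j - i"] pow_add[of "j - i" i a] by simp

definition proper :: "'a \<Rightarrow> bool" where
  "proper a \<longleftrightarrow> \<not> le (s a) a"

lemma proper_le: "proper b \<Longrightarrow> le a b \<Longrightarrow> proper a"
  unfolding proper_def by (meson le_suc suc_top trans)

lemma not_le_iff: "proper a \<Longrightarrow> \<not> le b a \<longleftrightarrow> le (s a) b"
  unfolding proper_def by (meson suc_le trans)

text \<open>Properness is asked of \<open>s b\<close> and not just of \<open>b\<close>: if the
  greatest element is the successor of a smaller one, \<open>s\<close> merges the two.\<close>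

lemma suc_cancel:
  assumes "proper (s b)"
  shows "le (s a) (s b) \<longleftrightarrow> le a b"
proof
  assume le: "le (s a) (s b)"
  show "le a b"
  proof (rule ccontr)
    assume "\<not> le a b"
    then have "le (s a) a" by (rule trans[OF le suc_le])
    then have "le (s (s b)) a" by (rule suc_top)
    then have "le (s (s b)) (s b)" using trans[OF trans[OF _ le_suc] le] by blast
    then show False using assms by (simp add: proper_def)
  qed
qed (rule suc_mono)

lemma pow_cancel: "proper ((s ^^ j) b) \<Longrightarrow> le ((s ^^ j) a) ((s ^^ j) b) \<longleftrightarrow> le a b"
proof (induction j)
  case (Suc j)
  then have "proper ((s ^^ j) b)" using proper_le[OF _ le_suc] by simp
  with Suc show ?case using suc_cancel[of "(s ^^ j) b"] by simp
qed simp

lemma pow_cancel_le: "proper ((s ^^ i) b) \<Longrightarrow> i \<le> j \<Longrightarrow>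
    le ((s ^^ j) a) ((s ^^ i) b) \<longleftrightarrow> le ((s ^^ (j - i)) a) b"
  using pow_cancel[of i b "(s ^^ (j - i)) a"] pow_add[of i "j - i" a] by simp

lemma pow_cancel_ge: "proper ((s ^^ i) b) \<Longrightarrow> j \<le> i \<Longrightarrow>
    le ((s ^^ j) a) ((s ^^ i) b) \<longleftrightarrow> le a ((s ^^ (i - j)) b)"
  using pow_cancel[of j "(s ^^ (i - j)) b" a] pow_add[of j "i - j" b] by simp

lemma pow_self: "proper a \<Longrightarrow> le ((s ^^ j) a) a \<longleftrightarrow> j = 0"
proof (cases j)
  case (Suc i)
  assume "proper a"
  then have "\<not> le (s a) a" by (simp add: proper_def)
  moreover have "le (s a) ((s ^^ j) a)" using pow_mono_exp[of 1 j a] Suc by simp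
  ultimately show ?thesis using Suc trans by blast
qed (simp add: refl)

text \<open>Nothing lies strictly between an element and its successor, so an element above
  \<open>a\<close> that misses the steps 0 to \<open>K\<close> is at or beyond the next one.\<close>

lemma pow_reach:
  assumes "le a c" "proper c" "\<And>i. i \<le> K \<Longrightarrow> \<not> (le ((s ^^ i) a) c \<and> le c ((s ^^ i) a))"
  shows "le ((s ^^ Suc K) a) c"
  using assms(3)
proof (induction K)
  case 0
  from 0[of 0] assms(1) show ?case using suc_le by simp
next
  case (Suc K)
  then have "le ((s ^^ Suc K) a) c" by simp
  with Suc.prems[of "Suc K"] show ?case using suc_le[of c "(s ^^ Suc K) a"] by simp
qed

text \<open>A gap of more than \<open>K\<close> steps settles every comparison with offset at most
  \<open>K\<close> in both directions; the far case of the game rests on this.\<close>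

lemma pow_gap:
  assumes "le ((s ^^ Suc K) x) w" "proper w" "j \<le> K"
  shows "le ((s ^^ j) x) w" "\<not> le ((s ^^ j) w) x"
proof -
  show "le ((s ^^ j) x) w"
    using trans[OF pow_mono_exp assms(1), of j] assms(3) by simp
  have "proper x" by (rule proper_le[OF assms(2) trans[OF le_pow assms(1)]])
  show "\<not> le ((s ^^ j) w) x"
  proof
    assume "le ((s ^^ j) w) x"
    then have "le ((s ^^ Suc K) x) x" using trans[OF assms(1) trans[OF le_pow]] by blast
    then show False using pow_self[OF \<open>proper x\<close>] by blast
  qed
qed

text \<open>The room above \<open>z\<close> ensures that \<open>pred\<close> yields a predecessor at
  each step, and properness lets the successor be cancelled.\<close>

lemma descend:
  assumes "le ((s ^^ i) z) b" "proper b"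
  shows "\<exists>c. le ((s ^^ i) c) b \<and> le b ((s ^^ i) c)"
  using assms
proof (induction i arbitrary: b)
  case (Suc i)
  have "\<not> le b z"
    using Suc.prems pow_self[of z "Suc i"] trans zero_least proper_le by (metis nat.distinct(1))
  then obtain q where q: "le (s q) b" "le b (s q)" using pred by blast
  have "proper (s q)" using q Suc.prems proper_le by blast
  then have "proper q" using proper_le le_suc by blast
  have "le ((s ^^ i) z) q"
    using trans[OF Suc.prems(1) q(2)] suc_cancel[OF \<open>proper (s q)\<close>] by simp
  from Suc.IH[OF this \<open>proper q\<close>] obtain c where "le ((s ^^ i) c) q" "le q ((s ^^ i) c)" by blast
  then have "le ((s ^^ Suc i) c) b" "le b ((s ^^ Suc i) c)"
    using trans[OF suc_mono q(1)] trans[OF q(2) suc_mono] by simp_all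
  then show ?case by blast
qed (auto intro: refl)

lemma finite_max:
  assumes "finite X" "X \<noteq> {}"
  shows "\<exists>m\<in>X. \<forall>x\<in>X. le (f x) (f m)"
  using assms
proof (induction rule: finite_ne_induct)
  case (insert x X)
  then obtain m where "m \<in> X" "\<forall>x\<in>X. le (f x) (f m)" by blast
  then show ?case using total[of "f m" "f x"] trans refl by (cases "le (f m) (f x)") (blast+)
qed (auto intro: refl)

lemma finite_min:
  assumes "finite X" "X \<noteq> {}"
  shows "\<exists>m\<in>X. \<forall>x\<in>X. le (f m) (f x)"
  using assms
proof (induction rule: finite_ne_induct)
  case (insert x X)
  then obtain m where "m \<in> X" "\<forall>x\<in>X. le (f m) (f x)" by blast
  then show ?case using total[of "f m" "f x"] trans refl by (cases "le (f m) (f x)") (blast+)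
qed (auto intro: refl)

end

section \<open>The game between two chains\<close>

text \<open>\<open>P\<close> is a finite partial correspondence containing the least elements and the worlds; it
  preserves all distances up to \<open>K\<close> between elements below the world, whereas elements
  above the world are only known to be above.\<close>

definition similar :: "('a \<Rightarrow> 'a \<Rightarrow> bool) \<Rightarrow> ('a \<Rightarrow> 'a) \<Rightarrow> 'a \<Rightarrow> ('b \<Rightarrow> 'b \<Rightarrow> bool) \<Rightarrow> ('b \<Rightarrow> 'b) \<Rightarrow> 'b \<Rightarrow>
    nat \<Rightarrow> ('a \<times> 'b) set \<Rightarrow> 'a \<Rightarrow> 'b \<Rightarrow> bool" where
  "similar le s z le' s' z' K P y y' \<longleftrightarrow> finite P \<and> (z, z') \<in> P \<and> (y, y') \<in> P \<and>
     \<not> le (s y) y \<and> \<not> le' (s' y') y' \<and>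
     (\<forall>a a' b b' j. (a, a') \<in> P \<longrightarrow> (b, b') \<in> P \<longrightarrow> le b y \<longrightarrow> j \<le> K \<longrightarrow>
       (le ((s ^^ j) a) b \<longleftrightarrow> le' ((s' ^^ j) a') b'))"

lemma similar_D:
  assumes "similar le s z le' s' z' K P y y'" "(a, a') \<in> P" "(b, b') \<in> P" "le b y" "j \<le> K"
  shows "le ((s ^^ j) a) b \<longleftrightarrow> le' ((s' ^^ j) a') b'"
  using assms unfolding similar_def by blast

locale two_chains = L: discrete_chain le s z + R: discrete_chain le' s' z'
  for le :: "'a \<Rightarrow> 'a \<Rightarrow> bool" and s z and le' :: "'b \<Rightarrow> 'b \<Rightarrow> bool" and s' z'
begin

abbreviation "sim \<equiv> similar le s z le' s' z'"

lemma sim_below: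
  assumes "sim K P y y'" "(a, a') \<in> P"
  shows "le a y \<longleftrightarrow> le' a' y'"
proof -
  have "(y, y') \<in> P" using assms(1) by (simp add: similar_def)
  then show ?thesis using similar_D[OF assms(1,2), of y y' 0] L.refl by simp
qed

lemma sim_mono: "sim K P y y' \<Longrightarrow> K' \<le> K \<Longrightarrow> sim K' P y y'"
  unfolding similar_def by (meson order_trans)

lemma sim_world:
  assumes "sim K P y y'" "(a, a') \<in> P" "le a y"
  shows "sim K P a a'"
proof -
  have "le' a' y'" using sim_below assms by blast
  then have "\<not> le (s a) a" "\<not> le' (s' a') a'"
    using assms L.proper_le R.proper_le unfolding similar_def L.proper_def R.proper_def by blast+
  moreover have "le b y" if "le b a" for b using that assms(3) L.trans by blast
  ultimately show ?thesis
    using assms unfolding similar_def by blast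
qed

text \<open>The restriction to elements below the world is itself transferred by
  \<open>sim_below\<close>, so the notion is symmetric although it is phrased on the left
  chain.\<close>

lemma sim_converse:
  assumes "sim K P y y'"
  shows "similar le' s' z' le s z K (P\<inverse>) y' y"
proof -
  have "le' ((s' ^^ j) a') b' \<longleftrightarrow> le ((s ^^ j) a) b"
    if "(a, a') \<in> P" "(b, b') \<in> P" "le' b' y'" "j \<le> K" for a a' b b' j
    using similar_D[OF assms that(1,2)] sim_below[OF assms that(2)] that by blast
  with assms show ?thesis unfolding similar_def by auto
qed

text \<open>Comparing \<open>c\<close> with itself is settled by \<open>pow_self\<close>, and if
  \<open>c\<close> is above the world then no iterated successor of it is below an element under the
  world. Only comparisons with old elements remain.\<close>

lemma sim_insert:
  assumes S: "sim K P y y'" and "le c y \<longleftrightarrow> le' c' y'"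
    and "\<And>a a' j. (a, a') \<in> P \<Longrightarrow> le c y \<Longrightarrow> j \<le> K \<Longrightarrow> le ((s ^^ j) a) c \<longleftrightarrow> le' ((s' ^^ j) a') c'"
    and "\<And>b b' j. (b, b') \<in> P \<Longrightarrow> le b y \<Longrightarrow> le c y \<Longrightarrow> j \<le> K \<Longrightarrow> le ((s ^^ j) c) b \<longleftrightarrow> le' ((s' ^^ j) c') b'"
  shows "sim K (insert (c, c') P) y y'"
proof -
  have y: "L.proper y" "R.proper y'" using S by (auto simp: similar_def L.proper_def R.proper_def)
  have *: "le ((s ^^ j) a) b \<longleftrightarrow> le' ((s' ^^ j) a') b'"
    if a: "(a, a') \<in> insert (c, c') P" and b: "(b, b') \<in> insert (c, c') P" and "le b y" "j \<le> K" for a a' b b' j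
  proof (cases "(b, b') \<in> P")
    case True
    have b': "le' b' y'" using True sim_below[OF S] \<open>le b y\<close> by blast
    show ?thesis
    proof (cases "(a, a') \<in> P")
      case True
      then show ?thesis using similar_D[OF S True \<open>(b, b') \<in> P\<close>] that by blast
    next
      case False
      then have [simp]: "a = c" "a' = c'" using a by auto
      show ?thesis
      proof (cases "le c y")
        case True
        then show ?thesis using assms(4) \<open>(b, b') \<in> P\<close> that by simp
      next
        case False
        then have "\<not> le' c' y'" using assms(2) by blast
        then have "\<not> le' ((s' ^^ j) a') b'" using b' R.trans R.le_pow by (metis \<open>a' = c'\<close>)
        moreover have "\<not> le ((s ^^ j) a) b" using False \<open>le b y\<close> L.trans L.le_pow by (metis \<open>a = c\<close>)
        ultimately show ?thesis by blast
      qed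
    qed
  next
    case False
    then have [simp]: "b = c" "b' = c'" using b by auto
    have c: "le c y" "le' c' y'" using \<open>le b y\<close> assms(2) by auto
    show ?thesis
    proof (cases "(a, a') \<in> P")
      case True
      then show ?thesis using assms(3) c \<open>j \<le> K\<close> by simp
    next
      case False
      then have [simp]: "a = c" "a' = c'" using a by auto
      show ?thesis using c y L.proper_le R.proper_le by (simp add: L.pow_self R.pow_self)
    qed
  qed
  show ?thesis using S * unfolding similar_def by auto
qed

text \<open>The answer copies the position of \<open>c\<close> relative to an element of
  \<open>P\<close> within \<open>K\<close> steps, or, if there is none, lands in the corresponding
  gap. Such a gap has length at least \<open>(K + 1) + (K + 1)\<close>, which is the origin of
  \<open>2 * K + 2\<close>.\<close>

lemma sim_forth:
  assumes S: "sim (2 * K + 2) P y y'"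
  shows "\<exists>c'. sim K (insert (c, c') P) y y'"
proof -
  have SK: "sim K P y y'" using S sim_mono by simp
  have y: "L.proper y" "R.proper y'" and yP: "(y, y') \<in> P" and zP: "(z, z') \<in> P" and fin: "finite P"
    using S by (auto simp: similar_def L.proper_def R.proper_def)
  note D = similar_D[OF S]
  note below = sim_below[OF S]
  consider (above) "\<not> le c y"
    | (up) a a' i where "le c y" "(a, a') \<in> P" "i \<le> K" "le ((s ^^ i) a) c" "le c ((s ^^ i) a)"
    | (down) b b' i where "le c y" "(b, b') \<in> P" "le b y" "i \<le> K" "le ((s ^^ i) c) b" "le b ((s ^^ i) c)"
    | (far) "le c y" "\<And>a a' i. (a, a') \<in> P \<Longrightarrow> i \<le> K \<Longrightarrow> \<not> (le ((s ^^ i) a) c \<and> le c ((s ^^ i) a))"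
       "\<And>b b' i. (b, b') \<in> P \<Longrightarrow> le b y \<Longrightarrow> i \<le> K \<Longrightarrow> \<not> (le ((s ^^ i) c) b \<and> le b ((s ^^ i) c))"
    by blast
  then show ?thesis
  proof cases
    case above
    \<comment> \<open>All elements above the world look alike, so the successor of the world is a
      valid answer.\<close>
    have "\<not> le' (s' y') y'" using y by (simp add: R.proper_def)
    with above have "sim K (insert (c, s' y') P) y y'"
      by (intro sim_insert[OF SK]) auto
    then show ?thesis by blast
  next
    case up
    let ?c' = "(s' ^^ i) a'"
    have "le ((s ^^ i) a) y" using up L.trans by blast
    then have c'y: "le' ?c' y'" using D[OF up(2) yP, of i] L.refl up(3) by simp
    then have a'y: "le' a' y'" using R.trans R.le_pow by blast
    have pc: "L.proper ((s ^^ i) a)" "R.proper ?c'"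
      using \<open>le ((s ^^ i) a) y\<close> c'y y L.proper_le R.proper_le by blast+
    have ay: "le a y" using a'y below up(2) by blast
    have "sim K (insert (c, ?c') P) y y'"
    proof (rule sim_insert[OF SK])
      fix e e' j assume e: "(e, e') \<in> P" and "j \<le> K"
      have c_eq: "le ((s ^^ j) e) c \<longleftrightarrow> le ((s ^^ j) e) ((s ^^ i) a)" using up L.trans by blast
      show "le ((s ^^ j) e) c \<longleftrightarrow> le' ((s' ^^ j) e') ?c'"
      proof (cases "i \<le> j")
        case True
        then show ?thesis
          unfolding c_eq L.pow_cancel_le[OF pc(1) True] R.pow_cancel_le[OF pc(2) True]
          using D[OF e up(2) ay] \<open>j \<le> K\<close> by simp
      next
        case False
        then have ji: "j \<le> i" by simp
        have 1: "L.proper ((s ^^ (i - j)) a)" "R.proper ((s' ^^ (i - j)) a')"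
          using pc L.proper_le[OF pc(1)] R.proper_le[OF pc(2)]
            L.pow_mono_exp[of "i-j" i a] R.pow_mono_exp[of "i-j" i a'] by auto
        show ?thesis
        proof (cases "le e y")
          case True
          \<comment> \<open>\<open>similar\<close> has iterated successors on the left only;
            negating the comparison moves them there at the cost of one more step.\<close>
          have "le e ((s ^^ (i - j)) a) \<longleftrightarrow> \<not> le ((s ^^ Suc (i - j)) a) e"
            using L.not_le_iff[OF 1(1), of e] by auto
          also have "\<dots> \<longleftrightarrow> \<not> le' ((s' ^^ Suc (i - j)) a') e'"
            using D[OF up(2) e True, of "Suc (i - j)"] up(3) by simp
          also have "\<dots> \<longleftrightarrow> le' e' ((s' ^^ (i - j)) a')"
            using R.not_le_iff[OF 1(2), of e'] by auto
          finally show ?thesis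
            unfolding c_eq L.pow_cancel_ge[OF pc(1) ji] R.pow_cancel_ge[OF pc(2) ji] .
        next
          case False
          then have "\<not> le' e' y'" using below e by blast
          then show ?thesis using False up(1) c'y L.trans R.trans L.le_pow R.le_pow by meson
        qed
      qed
    next
      fix e e' j assume e: "(e, e') \<in> P" "le e y" and "j \<le> K"
      have "le ((s ^^ j) c) e \<longleftrightarrow> le ((s ^^ (j + i)) a) e"
        unfolding L.pow_add using up L.trans L.pow_mono by meson
      then show "le ((s ^^ j) c) e \<longleftrightarrow> le' ((s' ^^ j) ?c') e'"
        using D[OF up(2) e, of "j + i"] \<open>j \<le> K\<close> up(3) by (simp add: R.pow_add)
    qed (use up c'y in auto)
    then show ?thesis by blast
  next
    case down
    have b'y: "le' b' y'" using below down by blast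
    have pb: "R.proper b'" "L.proper b" using y b'y down L.proper_le R.proper_le by blast+
    \<comment> \<open>The least elements belong to \<open>P\<close> so that the room for
      \<open>i\<close> steps down from \<open>b\<close> can be transferred.\<close>
    have "le ((s ^^ i) z) b" using down L.trans L.pow_mono[OF L.zero_least] by blast
    then have "le' ((s' ^^ i) z') b'" using D[OF zP down(2,3)] down(4) by simp
    then obtain c' where c': "le' ((s' ^^ i) c') b'" "le' b' ((s' ^^ i) c')"
      using R.descend pb by blast
    have pc: "L.proper ((s ^^ i) c)" "R.proper ((s' ^^ i) c')"
      using down c' pb L.proper_le R.proper_le by blast+
    have c'b: "le' c' b'" using c' R.trans R.le_pow by blast
    have c'y: "le' c' y'" using c'b b'y R.trans by blast
    have b_cong: "le x b \<longleftrightarrow> le x ((s ^^ i) c)" "le' x' b' \<longleftrightarrow> le' x' ((s' ^^ i) c')"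
      "le b x \<longleftrightarrow> le ((s ^^ i) c) x" "le' b' x' \<longleftrightarrow> le' ((s' ^^ i) c') x'" for x x'
      using down c' L.trans R.trans by blast+
    have step: "le x c \<longleftrightarrow> le ((s ^^ i) x) b" "le' x' c' \<longleftrightarrow> le' ((s' ^^ i) x') b'" for x x'
      unfolding b_cong using L.pow_cancel[OF pc(1)] R.pow_cancel[OF pc(2)] by blast+
    have "sim K (insert (c, c') P) y y'"
    proof (rule sim_insert[OF SK])
      fix e e' j assume e: "(e, e') \<in> P" and "j \<le> K"
      show "le ((s ^^ j) e) c \<longleftrightarrow> le' ((s' ^^ j) e') c'"
        unfolding step using D[OF e down(2,3), of "i + j"] \<open>j \<le> K\<close> \<open>i \<le> K\<close>
        by (simp add: L.pow_add R.pow_add)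
    next
      fix e e' j assume e: "(e, e') \<in> P" "le e y" and "j \<le> K"
      have pe: "L.proper e" "R.proper e'" using e below y L.proper_le R.proper_le by blast+
      show "le ((s ^^ j) c) e \<longleftrightarrow> le' ((s' ^^ j) c') e'"
      proof (cases "i \<le> j")
        case True
        then have "(s ^^ j) c = (s ^^ (j - i)) ((s ^^ i) c)" "(s' ^^ j) c' = (s' ^^ (j - i)) ((s' ^^ i) c')"
          using L.pow_add[of "j - i" i] R.pow_add[of "j - i" i] by simp_all
        moreover have "le ((s ^^ (j - i)) ((s ^^ i) c)) e \<longleftrightarrow> le ((s ^^ (j - i)) b) e"
          using down L.trans L.pow_mono by meson
        moreover have "le' ((s' ^^ (j - i)) ((s' ^^ i) c')) e' \<longleftrightarrow> le' ((s' ^^ (j - i)) b') e'"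
          using c' R.trans R.pow_mono by meson
        ultimately show ?thesis using D[OF down(2) e, of "j - i"] \<open>j \<le> K\<close> by simp
      next
        case False
        then have ji: "i = (i - j) + j" by simp
        \<comment> \<open>Adding \<open>i - j\<close> successors on both sides turns the comparison
          with \<open>c\<close> into one with \<open>b\<close>, whose counterpart is known.\<close>
        have "\<not> le ((s ^^ j) c) e \<longleftrightarrow> le (s e) ((s ^^ j) c)" by (rule L.not_le_iff[OF pe(1)])
        also have "\<dots> \<longleftrightarrow> le ((s ^^ (i - j)) (s e)) ((s ^^ (i - j)) ((s ^^ j) c))"
          using L.pow_cancel[of "i - j" "(s ^^ j) c" "s e"] pc ji L.pow_add by metis
        also have "\<dots> \<longleftrightarrow> le ((s ^^ Suc (i - j)) e) b"
          unfolding b_cong by (metis L.pow_add ji funpow_Suc_right comp_apply)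
        finally have 1: "\<not> le ((s ^^ j) c) e \<longleftrightarrow> le ((s ^^ Suc (i - j)) e) b" .
        have "\<not> le' ((s' ^^ j) c') e' \<longleftrightarrow> le' (s' e') ((s' ^^ j) c')" by (rule R.not_le_iff[OF pe(2)])
        also have "\<dots> \<longleftrightarrow> le' ((s' ^^ (i - j)) (s' e')) ((s' ^^ (i - j)) ((s' ^^ j) c'))"
          using R.pow_cancel[of "i - j" "(s' ^^ j) c'" "s' e'"] pc ji R.pow_add by metis
        also have "\<dots> \<longleftrightarrow> le' ((s' ^^ Suc (i - j)) e') b'"
          unfolding b_cong by (metis R.pow_add ji funpow_Suc_right comp_apply)
        finally have 2: "\<not> le' ((s' ^^ j) c') e' \<longleftrightarrow> le' ((s' ^^ Suc (i - j)) e') b'" .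
        show ?thesis using 1 2 D[OF e(1) down(2,3), of "Suc (i - j)"] \<open>i \<le> K\<close> by auto
      qed
    qed (use down c'y in auto)
    then show ?thesis by blast
  next
    case far
    have "finite {x\<in>P. le (fst x) c}" "{x\<in>P. le (fst x) c} \<noteq> {}" using fin zP L.zero_least by force+
    from L.finite_max[OF this, of fst] obtain a a' where a: "(a, a') \<in> P" "le a c"
      and amax: "\<And>e e'. (e, e') \<in> P \<Longrightarrow> le e c \<Longrightarrow> le e a" by force
    have "finite {x\<in>P. le c (fst x)}" "{x\<in>P. le c (fst x)} \<noteq> {}" using fin yP far(1) by force+
    from L.finite_min[OF this, of fst] obtain b b' where b: "(b, b') \<in> P" "le c b"
      and bmin: "\<And>e e'. (e, e') \<in> P \<Longrightarrow> le c e \<Longrightarrow> le b e" by force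
    have bY: "le b y" using bmin yP far by blast
    have b'y: "le' b' y'" using below b bY by blast
    have ay: "le a y" using a far L.trans by blast
    have pc: "L.proper c" and pb: "L.proper b" "R.proper b'" using far bY b'y y L.proper_le R.proper_le by blast+
    have ac: "le ((s ^^ Suc K) a) c" using L.pow_reach[OF a(2) pc] far(2) a(1) by blast
    have cb: "le ((s ^^ Suc K) c) b" using L.pow_reach[OF b(2) pb(1)] far(3) b(1) bY by blast
    have "le ((s ^^ (Suc K + Suc K)) a) b"
      unfolding L.pow_add using L.pow_mono[OF ac] cb L.trans by blast
    moreover have "Suc K + Suc K \<le> 2 * K + 2" by simp
    ultimately have "le' ((s' ^^ (Suc K + Suc K)) a') b'"
      using D[OF a(1) b(1) bY] by blast
    \<comment> \<open>Exactly \<open>K + 1\<close> steps above the lower neighbour leaves at least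
      \<open>K + 1\<close> steps to the upper one.\<close>
    define c' where "c' = (s' ^^ Suc K) a'"
    have c'b: "le' ((s' ^^ Suc K) c') b'"
      using \<open>le' ((s' ^^ (Suc K + Suc K)) a') b'\<close> unfolding c'_def R.pow_add .
    then have "le' c' b'" using R.le_pow R.trans by blast
    then have c'y: "le' c' y'" using b'y R.trans by blast
    have pc': "R.proper c'" using c'y y R.proper_le by blast
    have cmp: "(le ((s ^^ Suc K) e) c \<and> le' ((s' ^^ Suc K) e') c') \<or>
      (le ((s ^^ Suc K) c) e \<and> le' ((s' ^^ Suc K) c') e')" if e: "(e, e') \<in> P" for e e'
    proof (cases "le e c")
      case True
      then have "le e a" using amax e by blast
      then have "le' e' a'" using D[OF e a(1) ay, of 0] by simp
      then show ?thesis using \<open>le e a\<close> L.pow_mono R.pow_mono ac L.trans unfolding c'_def by blast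
    next
      case False
      then have "le b e" using L.total bmin e by blast
      moreover have "le' b' e'"
      proof (cases "le e y")
        case True
        then show ?thesis using D[OF b(1) e True, of 0] \<open>le b e\<close> by simp
      next
        case False
        then show ?thesis using below[OF e] b'y R.total R.trans by blast
      qed
      ultimately show ?thesis using cb c'b L.trans R.trans by blast
    qed
    have "sim K (insert (c, c') P) y y'"
    proof (rule sim_insert[OF SK])
      fix e e' j assume e: "(e, e') \<in> P" and "j \<le> K"
      show "le ((s ^^ j) e) c \<longleftrightarrow> le' ((s' ^^ j) e') c'"
      proof (cases "le ((s ^^ Suc K) e) c \<and> le' ((s' ^^ Suc K) e') c'")
        case True
        then show ?thesis using L.pow_gap(1) R.pow_gap(1) pc pc' \<open>j \<le> K\<close> by blast
      next
        case False
        then have 1: "le ((s ^^ Suc K) c) e" "le' ((s' ^^ Suc K) c') e'" using cmp e by blast+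
        then have "\<not> le e c" "\<not> le' e' c'"
          using L.pow_self[OF pc, of "Suc K"] R.pow_self[OF pc', of "Suc K"] L.trans R.trans by blast+
        then show ?thesis using L.trans[OF L.le_pow] R.trans[OF R.le_pow] by blast
      qed
    next
      fix e e' j assume e: "(e, e') \<in> P" "le e y" and "j \<le> K"
      have pe: "L.proper e" "R.proper e'" using e below y L.proper_le R.proper_le by blast+
      show "le ((s ^^ j) c) e \<longleftrightarrow> le' ((s' ^^ j) c') e'"
        using cmp[OF e(1)] L.pow_gap R.pow_gap pc pc' pe \<open>j \<le> K\<close> by blast
    qed (use far c'y in auto)
    then show ?thesis by blast
  qed
qed

lemma sim_back:
  assumes "sim (2 * K + 2) P y y'"
  shows "\<exists>c. sim K (insert (c, c') P) y y'"
proof -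
  interpret C: two_chains le' s' z' le s z by unfold_locales
  from C.sim_forth[OF sim_converse[OF assms], of c'] obtain c where
    "similar le' s' z' le s z K (insert (c', c) (P\<inverse>)) y' y" by blast
  from C.sim_converse[OF this] have "sim K ((insert (c', c) (P\<inverse>))\<inverse>) y y'" .
  moreover have "(insert (c', c) (P\<inverse>))\<inverse> = insert (c, c') P" by auto
  ultimately have "sim K (insert (c, c') P) y y'" by simp
  then show ?thesis by blast
qed

end

text \<open>One move of the game needs \<open>2 * K + 2\<close> to guarantee \<open>K\<close> afterwards, see \<open>sim_forth\<close>; implication
  and \<open>Circ\<close> cost a move because they pass to a lower world.\<close>

primrec radius :: "fm \<Rightarrow> nat" where
  "radius (Atom q) = 0"
| "radius Bot = 0"
| "radius Top = 0"
| "radius (A \<^bold>\<and> B) = max (radius A) (radius B)"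
| "radius (A \<^bold>\<or> B) = max (radius A) (radius B)"
| "radius (A \<^bold>\<supset> B) = 2 * max (radius A) (radius B) + 2"
| "radius (Circ A) = 2 * radius A + 2"
| "radius (Forall q A) = 2 * radius A + 2"
| "radius (Exists q A) = 2 * radius A + 2"

section \<open>Transfer of forcing and the opening position\<close>

context two_chains begin

text \<open>A quantifier adds a value and keeps the world; implication and \<open>Circ\<close> add a
  lower element, which \<open>sim_world\<close> makes the new world. Worlds only descend, so details
  above the world are never asked for.\<close>

theorem sim_forces:
  assumes "sim (radius A) P y y'" "\<And>p. p \<in> fv A \<Longrightarrow> (f p, g p) \<in> P"
  shows "forces le f y A \<longleftrightarrow> forces le' g y' A"
  using assms
proof (induction A arbitrary: f g P y y')
  case (Atom p)
  then show ?case using sim_below[OF Atom(1), of "f p" "g p"] by simp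
next
  case (And A B)
  have "sim (radius A) P y y'" "sim (radius B) P y y'" using And.prems sim_mono by auto
  then have "forces le f y A \<longleftrightarrow> forces le' g y' A" "forces le f y B \<longleftrightarrow> forces le' g y' B"
    using And.prems(2) by (auto intro!: And.IH)
  then show ?case by simp
next
  case (Or A B)
  have "sim (radius A) P y y'" "sim (radius B) P y y'" using Or.prems sim_mono by auto
  then have "forces le f y A \<longleftrightarrow> forces le' g y' A" "forces le f y B \<longleftrightarrow> forces le' g y' B"
    using Or.prems(2) by (auto intro!: Or.IH)
  then show ?case by simp
next
  case (Imp A B)
  let ?K = "max (radius A) (radius B)"
  have *: "(forces le f c A \<longleftrightarrow> forces le' g c' A) \<and> (forces le f c B \<longleftrightarrow> forces le' g c' B)"
    if "sim ?K (insert (c, c') P) y y'" "le c y" for c c'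
  proof -
    have "sim ?K (insert (c, c') P) c c'" using sim_world[OF that(1) _ that(2)] by simp
    then have "sim (radius A) (insert (c, c') P) c c'" "sim (radius B) (insert (c, c') P) c c'"
      using sim_mono by auto
    then show ?thesis using Imp.prems(2) by (auto intro!: Imp.IH)
  qed
  have S: "sim (2 * ?K + 2) P y y'" using Imp.prems by simp
  show ?case
  proof
    assume L: "forces le f y (A \<^bold>\<supset> B)"
    have "forces le' g c' B" if "le' c' y'" "forces le' g c' A" for c'
    proof -
      from sim_back[OF S] obtain c where c: "sim ?K (insert (c, c') P) y y'" by blast
      then have "le c y" using sim_below[OF c] that by blast
      then show ?thesis using *[OF c \<open>le c y\<close>] L that \<open>le c y\<close> unfolding forces.simps by blast
    qed
    then show "forces le' g y' (A \<^bold>\<supset> B)" by simp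
  next
    assume R: "forces le' g y' (A \<^bold>\<supset> B)"
    have "forces le f c B" if "le c y" "forces le f c A" for c
    proof -
      from sim_forth[OF S] obtain c' where c: "sim ?K (insert (c, c') P) y y'" by blast
      then have "le' c' y'" using sim_below[OF c] that by blast
      then show ?thesis using *[OF c \<open>le c y\<close>] R that unfolding forces.simps by blast
    qed
    then show "forces le f y (A \<^bold>\<supset> B)" by simp
  qed
next
  case (Circ A)
  have yP: "(y, y') \<in> P" using Circ.prems by (simp add: similar_def)
  have *: "(forces le f c A \<longleftrightarrow> forces le' g c' A) \<and> (le y c \<longleftrightarrow> le' y' c')"
    if S: "sim (radius A) (insert (c, c') P) y y'" "le c y" for c c'
  proof -
    have "sim (radius A) (insert (c, c') P) c c'" using sim_world[OF that(1) _ that(2)] by simp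
    then have "forces le f c A \<longleftrightarrow> forces le' g c' A" using Circ.prems(2) by (auto intro!: Circ.IH)
    then show ?thesis using similar_D[OF S(1), of y y' c c' 0] yP S by simp
  qed
  have S: "sim (2 * radius A + 2) P y y'" using Circ.prems by simp
  show ?case
  proof
    assume L: "forces le f y (Circ A)"
    have "forces le' g c' A" if "le' c' y'" "\<not> le' y' c'" for c'
    proof -
      from sim_back[OF S] obtain c where c: "sim (radius A) (insert (c, c') P) y y'" by blast
      then have "le c y" using sim_below[OF c] that by blast
      then show ?thesis using *[OF c \<open>le c y\<close>] L that \<open>le c y\<close> unfolding forces.simps by blast
    qed
    then show "forces le' g y' (Circ A)" by simp
  next
    assume R: "forces le' g y' (Circ A)"
    have "forces le f c A" if "le c y" "\<not> le y c" for c
    proof -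
      from sim_forth[OF S] obtain c' where c: "sim (radius A) (insert (c, c') P) y y'" by blast
      then have "le' c' y'" using sim_below[OF c] that by blast
      then show ?thesis using *[OF c \<open>le c y\<close>] R that unfolding forces.simps by blast
    qed
    then show "forces le f y (Circ A)" by simp
  qed
next
  case (Forall p A)
  have S: "sim (2 * radius A + 2) P y y'" using Forall.prems by simp
  have *: "forces le (f(p := c)) y A \<longleftrightarrow> forces le' (g(p := c')) y' A"
    if "sim (radius A) (insert (c, c') P) y y'" for c c'
    by (rule Forall.IH[OF that]) (use Forall.prems(2) in auto)
  have "(\<forall>c. forces le (f(p := c)) y A) \<longleftrightarrow> (\<forall>c. forces le' (g(p := c)) y' A)"
    using sim_forth[OF S] sim_back[OF S] * by blast
  then show ?case by (simp del: fun_upd_apply)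
next
  case (Exists p A)
  have S: "sim (2 * radius A + 2) P y y'" using Exists.prems by simp
  have *: "forces le (f(p := c)) y A \<longleftrightarrow> forces le' (g(p := c')) y' A"
    if "sim (radius A) (insert (c, c') P) y y'" for c c'
    by (rule Exists.IH[OF that]) (use Exists.prems(2) in auto)
  have "(\<exists>c. forces le (f(p := c)) y A) \<longleftrightarrow> (\<exists>c. forces le' (g(p := c)) y' A)"
    using sim_forth[OF S] sim_back[OF S] * by blast
  then show ?case by (simp del: fun_upd_apply)
qed simp_all

text \<open>By \<open>inf\<close> every iterated successor of \<open>z'\<close> is proper, so one of
  them can stand for \<open>y\<close> once all large distances from \<open>z\<close> are
  identified.\<close>

lemma sim_start:
  assumes y: "\<not> le (s y) y" and inf: "\<And>j. \<not> le' (s' ((s' ^^ j) z')) ((s' ^^ j) z')"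
  shows "\<exists>P y'. sim K P y y'"
proof -
  have pinf: "R.proper ((s' ^^ j) z')" for j using inf by (simp add: R.proper_def)
  have py: "L.proper y" using y by (simp add: L.proper_def)
  \<comment> \<open>The bound is \<open>Suc K\<close> rather than \<open>K\<close> so that even for
    \<open>K = 0\<close> it is known whether \<open>y\<close> lies strictly above
    \<open>z\<close>.\<close>
  let ?J = "{j. j \<le> Suc K \<and> le ((s ^^ j) z) y}"
  define n where "n = Max ?J"
  have fin: "finite ?J" "?J \<noteq> {}" using L.zero_least by (auto intro: exI[of _ 0])
  then have n: "n \<in> ?J" unfolding n_def by (rule Max_in)
  have le_n: "le ((s ^^ j) z) y \<longleftrightarrow> j \<le> n" if "j \<le> Suc K" for j
  proof
    assume "le ((s ^^ j) z) y"
    then show "j \<le> n" unfolding n_def using that fin by (intro Max_ge) auto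
  next
    assume "j \<le> n"
    then show "le ((s ^^ j) z) y" using L.trans[OF L.pow_mono_exp] n by blast
  qed
  define y' where "y' = (s' ^^ n) z'"
  have py': "R.proper y'" unfolding y'_def by (rule pinf)
  have le_n': "le' ((s' ^^ j) z') y' \<longleftrightarrow> j \<le> n" for j
  proof
    assume "le' ((s' ^^ j) z') y'"
    show "j \<le> n"
    proof (rule ccontr)
      assume "\<not> j \<le> n"
      then have "le' ((s' ^^ Suc n) z') ((s' ^^ j) z')" using R.pow_mono_exp[of "Suc n" j z'] by simp
      then have "le' (s' ((s' ^^ n) z')) ((s' ^^ n) z')"
        using R.trans[OF _ \<open>le' ((s' ^^ j) z') y'\<close>] by (simp add: y'_def)
      then show False using inf by blast
    qed
  qed (simp add: y'_def R.pow_mono_exp)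
  have y0: "le y z \<longleftrightarrow> n = 0"
  proof -
    have "L.proper z" using L.proper_le[OF py L.zero_least] .
    then show ?thesis using L.not_le_iff[of z y] le_n[of 1] by auto
  qed
  have y0': "le' y' z' \<longleftrightarrow> n = 0"
    using R.pow_self[OF pinf[of 0], of n] by (simp add: y'_def)
  have yj: "le ((s ^^ j) y) z \<longleftrightarrow> le' ((s' ^^ j) y') z'" for j
  proof (cases j)
    case 0
    then show ?thesis using y0 y0' by simp
  next
    case (Suc i)
    then have "\<not> le ((s ^^ j) y) z" "\<not> le' ((s' ^^ j) y') z'"
      using L.pow_self[OF py, of j] R.pow_self[OF py', of j] L.trans[OF _ L.zero_least] R.trans[OF _ R.zero_least]
      by blast+
    then show ?thesis by blast
  qed
  have "sim K {(z, z'), (y, y')} y y'"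
    unfolding similar_def
    using y py' le_n le_n' yj L.pow_self[OF py] R.pow_self[OF py']
      L.pow_self[OF L.proper_le[OF py L.zero_least]] R.pow_self[OF R.proper_le[OF py' R.zero_least]]
    by (auto simp: R.proper_def)
  then show ?thesis by blast
qed

text \<open>Each variable costs one move, so \<open>K\<close> varies in the induction: the game
  opens with a larger radius and ends with the required one.\<close>

lemma sim_exists:
  assumes "finite F" "\<not> le (s y) y" "\<And>j. \<not> le' (s' ((s' ^^ j) z')) ((s' ^^ j) z')"
  shows "\<exists>P y' g. sim K P y y' \<and> (\<forall>p\<in>F. (f p, g p) \<in> P)"
  using assms(1)
proof (induction F arbitrary: K rule: finite_induct)
  case empty
  then show ?case using sim_start[OF assms(2,3)] by simp
next
  case (insert q F)
  obtain P y' g where S: "sim (2 * K + 2) P y y'" and g: "\<forall>p\<in>F. (f p, g p) \<in> P"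
    using insert.IH by blast
  obtain c where c: "sim K (insert (f q, c) P) y y'" using sim_forth[OF S] by blast
  moreover have "\<forall>p\<in>insert q F. (f p, (g(q := c)) p) \<in> insert (f q, c) P"
    using g insert.hyps by auto
  ultimately show ?case by blast
qed

theorem forces_transfer:
  assumes "\<not> le (s y) y" "\<And>j. \<not> le' (s' ((s' ^^ j) z')) ((s' ^^ j) z')"
  shows "\<exists>g y'. \<not> le' (s' y') y' \<and> (forces le f y A \<longleftrightarrow> forces le' g y' A)"
proof -
  have "finite (fv A)" by (induction A) auto
  from sim_exists[OF this assms] obtain P y' g where
    "sim (radius A) P y y'" "\<forall>p\<in>fv A. (f p, g p) \<in> P" by blast
  then show ?thesis using sim_forces[of A P y y' f g] by (auto simp: similar_def)
qed

end

section \<open>Valuations in \<open>V_up\<close>\<close>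

definition V_enum :: "enat \<Rightarrow> real" where
  "V_enum n = (case n of enat k \<Rightarrow> 1 - 1 / real (Suc k) | \<infinity> \<Rightarrow> 1)"

lemma V_up_eq_range: "V_up = range V_enum"
proof (rule set_eqI)
  fix x
  have "x \<in> V_up \<longleftrightarrow> x = 1 \<or> (\<exists>k. x = 1 - 1 / real (Suc k))"
  proof -
    have "(\<exists>n. x = 1 - 1 / real n \<and> n \<ge> 1) \<longleftrightarrow> (\<exists>k. x = 1 - 1 / real (Suc k))"
      by (metis Suc_le_D One_nat_def le_add1 plus_1_eq_Suc)
    then show ?thesis unfolding V_up_def by blast
  qed
  also have "\<dots> \<longleftrightarrow> x \<in> range V_enum"
    unfolding V_enum_def image_iff by (auto split: enat.splits intro: exI[of _ \<infinity>] exI[of _ "enat _"])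
  finally show "x \<in> V_up \<longleftrightarrow> x \<in> range V_enum" .
qed

lemma V_enum_less_iff: "V_enum a < V_enum b \<longleftrightarrow> a < b"
  by (cases a; cases b) (auto simp: V_enum_def field_simps)

lemma V_enum_0 [simp]: "V_enum 0 = 0"
  by (simp add: V_enum_def zero_enat_def)

lemma V_enum_le_iff: "V_enum a \<le> V_enum b \<longleftrightarrow> a \<le> b"
  using V_enum_less_iff[of b a] by (simp add: not_less [symmetric])

lemma V_enum_le_1: "V_enum a \<le> 1"
  by (cases a) (auto simp: V_enum_def)

lemma V_enum_less_1: "V_enum (enat n) < 1"
  by (auto simp: V_enum_def)

text \<open>Equivalent to membership in \<open>V_up\<close>, but phrased by inequalities that pass
  through infima and suprema without asking whether these are attained.\<close>

definition gapped :: "real \<Rightarrow> bool" where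
  "gapped r \<longleftrightarrow> 0 \<le> r \<and> r \<le> 1 \<and> (\<forall>n. V_enum (enat n) < r \<longrightarrow> V_enum (enat (Suc n)) \<le> r)"

lemma gapped_V_enum: "gapped (V_enum a)"
  unfolding gapped_def V_enum_less_iff V_enum_le_iff
  using V_enum_le_iff[of 0 a] V_enum_le_1[of a] by (auto simp: Suc_ile_eq)

text \<open>Strictness survives the infimum because each value above a point of \<open>V_up\<close>
  is at least the next point.\<close>

lemma gapped_INF:
  assumes "\<And>w. gapped (g w)"
  shows "gapped (INF w. g (w :: enat))" "V_enum (enat n) < (INF w. g w) \<longleftrightarrow> (\<forall>w. V_enum (enat n) < g w)"
proof -
  have bdd: "bdd_below (range g)" using assms unfolding gapped_def by (intro bdd_belowI[of _ 0]) auto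
  have low: "(INF w. g w) \<le> g w" for w by (rule cINF_lower[OF bdd]) simp
  have Suc: "V_enum (enat (Suc n)) \<le> (INF w. g w)" if "\<And>w. V_enum (enat n) < g w" for n
    using that assms unfolding gapped_def by (intro cINF_greatest) auto
  have iff: "V_enum (enat n) < (INF w. g w) \<longleftrightarrow> (\<forall>w. V_enum (enat n) < g w)" for n
  proof
    assume "\<forall>w. V_enum (enat n) < g w"
    then have "V_enum (enat (Suc n)) \<le> (INF w. g w)" using Suc by blast
    then show "V_enum (enat n) < (INF w. g w)"
      using V_enum_less_iff[of "enat n" "enat (Suc n)"] by simp
  qed (use low less_le_trans in blast)
  then show "V_enum (enat n) < (INF w. g w) \<longleftrightarrow> (\<forall>w. V_enum (enat n) < g w)" .
  have "0 \<le> (INF w. g w)" using assms unfolding gapped_def by (intro cINF_greatest) auto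
  moreover have "(INF w. g w) \<le> 1" using low[of 0] assms[of 0] unfolding gapped_def by linarith
  ultimately show "gapped (INF w. g w)" unfolding gapped_def using iff Suc by blast
qed

lemma gapped_SUP:
  assumes "\<And>w. gapped (g w)"
  shows "gapped (SUP w. g (w :: enat))" "V_enum (enat n) < (SUP w. g w) \<longleftrightarrow> (\<exists>w. V_enum (enat n) < g w)"
proof -
  have bdd: "bdd_above (range g)" using assms unfolding gapped_def by (intro bdd_aboveI[of _ 1]) auto
  have upp: "g w \<le> (SUP w. g w)" for w by (rule cSUP_upper[OF _ bdd]) simp
  have iff: "V_enum (enat n) < (SUP w. g w) \<longleftrightarrow> (\<exists>w. V_enum (enat n) < g w)" for n
    using less_cSUP_iff[OF _ bdd] by simp
  then show "V_enum (enat n) < (SUP w. g w) \<longleftrightarrow> (\<exists>w. V_enum (enat n) < g w)" .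
  have "(SUP w. g w) \<le> 1" using assms unfolding gapped_def by (intro cSUP_least) auto
  moreover have "0 \<le> (SUP w. g w)" using upp[of 0] assms[of 0] unfolding gapped_def by linarith
  moreover have "V_enum (enat (Suc n)) \<le> (SUP w. g w)" if "V_enum (enat n) < (SUP w. g w)" for n
  proof -
    from that iff obtain w where "V_enum (enat n) < g w" by blast
    then have "V_enum (enat (Suc n)) \<le> g w" using assms unfolding gapped_def by blast
    then show ?thesis using upp[of w] by linarith
  qed
  ultimately show "gapped (SUP w. g w)" unfolding gapped_def by blast
qed

lemma gapped_imp:
  assumes "gapped a" "gapped b"
  shows "gapped (goedel_imp a b)"
    "V_enum (enat n) < goedel_imp a b \<longleftrightarrow> (\<forall>m\<le>n. V_enum (enat m) < a \<longrightarrow> V_enum (enat m) < b)"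
proof -
  show "gapped (goedel_imp a b)"
    using assms gapped_V_enum[of \<infinity>] by (auto simp: goedel_imp_def V_enum_def)
  show "V_enum (enat n) < goedel_imp a b \<longleftrightarrow> (\<forall>m\<le>n. V_enum (enat m) < a \<longrightarrow> V_enum (enat m) < b)"
  proof (cases "a \<le> b")
    case True
    then show ?thesis using V_enum_less_1 by (auto simp: goedel_imp_def)
  next
    case False
    have "V_enum (enat n) < b" if *: "\<forall>m\<le>n. V_enum (enat m) < a \<longrightarrow> V_enum (enat m) < b"
    proof -
      \<comment> \<open>A point at most \<open>b\<close> is below \<open>a\<close>, hence strictly
        below \<open>b\<close> by the hypothesis; the gap then puts the next point at most
        \<open>b\<close>.\<close>
      have "V_enum (enat m) < b" if "m \<le> n" for m
        using that
      proof (induction m)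
        case 0
        have "V_enum (enat 0) < a" using False assms(2) by (simp add: gapped_def flip: zero_enat_def)
        then show ?case using * by simp
      next
        case (Suc m)
        then have "V_enum (enat (Suc m)) \<le> b" using assms(2) unfolding gapped_def by simp
        then show ?case using * Suc.prems False by auto
      qed
      then show ?thesis by simp
    qed
    moreover have "V_enum (enat m) < b" if "V_enum (enat n) < b" "m \<le> n" for m
      using V_enum_le_iff[of "enat m" "enat n"] that by simp
    moreover have "goedel_imp a b = b" using False by (simp add: goedel_imp_def)
    ultimately show ?thesis by metis
  qed
qed

lemma le_enat_iff: "z \<le> enat n \<longleftrightarrow> (\<exists>m\<le>n. z = enat m)"
  by (cases z) auto

text \<open>\<open>gapped\<close> is carried along because infima, implication and
  \<open>Circ\<close> rely on it. Worlds are finite because no value exceeds 1, the point of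
  infinite index.\<close>

lemma eval_iff_forces:
  "gapped (eval (\<lambda>q. V_enum (v q)) A) \<and>
   (\<forall>n. V_enum (enat n) < eval (\<lambda>q. V_enum (v q)) A \<longleftrightarrow> forces (\<le>) v (enat n) A)"
proof (induction A arbitrary: v)
  case (Atom q)
  then show ?case using gapped_V_enum by (auto simp: V_enum_less_iff not_le)
next
  case Bot
  have "\<not> V_enum a < 0" for a using V_enum_le_iff[of 0 a] by simp
  then show ?case using gapped_V_enum[of 0] by simp
next
  case Top
  then show ?case using gapped_V_enum[of \<infinity>] V_enum_less_1 by (simp add: V_enum_def)
next
  case (And A B)
  have "gapped (min a b)" if "gapped a" "gapped b" for a b using that by (simp add: min_def)
  then show ?case using And.IH[of v] by simp
next
  case (Or A B)
  have "gapped (max a b)" if "gapped a" "gapped b" for a b using that by (simp add: max_def)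
  then show ?case using Or.IH[of v] by (simp add: less_max_iff_disj)
next
  case (Imp A B)
  have "forces (\<le>) v (enat n) (A \<^bold>\<supset> B) \<longleftrightarrow>
      (\<forall>m\<le>n. forces (\<le>) v (enat m) A \<longrightarrow> forces (\<le>) v (enat m) B)" for n
    by (auto simp: le_enat_iff)
  then show ?case
    using Imp.IH[of v] gapped_imp[of "eval (\<lambda>q. V_enum (v q)) A" "eval (\<lambda>q. V_enum (v q)) B"] by simp
next
  case (Circ A)
  let ?a = "eval (\<lambda>q. V_enum (v q)) A"
  let ?g = "\<lambda>w. max (goedel_imp (V_enum w) ?a) (V_enum w)"
  have gap: "gapped ?a" using Circ by blast
  have "gapped (?g w)" for w
    using gapped_imp(1)[OF gapped_V_enum gap, of w] gapped_V_enum[of w] by (simp add: max_def)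
  note INF = gapped_INF[of ?g, OF this]
  have eq: "eval (\<lambda>q. V_enum (v q)) (Circ A) = (INF w. ?g w)" by (simp add: V_up_eq_range image_image)
  have "(\<forall>w. V_enum (enat n) < ?g w) \<longleftrightarrow> (\<forall>m<n. V_enum (enat m) < ?a)" for n
  proof -
    \<comment> \<open>The choice \<open>w = enat n\<close> is decisive: there the maximum exceeds
      \<open>V_enum (enat n)\<close> only if the implication has value 1.\<close>
    have "(\<forall>w. V_enum (enat n) < ?g w) \<longleftrightarrow> V_enum (enat n) \<le> ?a"
    proof
      assume "\<forall>w. V_enum (enat n) < ?g w"
      then have "V_enum (enat n) < ?g (enat n)" by blast
      then show "V_enum (enat n) \<le> ?a" by (auto simp: goedel_imp_def split: if_splits)
    next
      assume "V_enum (enat n) \<le> ?a"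
      then show "\<forall>w. V_enum (enat n) < ?g w" using V_enum_less_1 by (auto simp: goedel_imp_def less_max_iff_disj)
    qed
    also have "\<dots> \<longleftrightarrow> (\<forall>m<n. V_enum (enat m) < ?a)"
    proof
      assume "V_enum (enat n) \<le> ?a"
      then show "\<forall>m<n. V_enum (enat m) < ?a" using V_enum_less_iff less_le_trans enat_ord_simps(2) by metis
    next
      assume "\<forall>m<n. V_enum (enat m) < ?a"
      then show "V_enum (enat n) \<le> ?a"
        using gap by (cases n) (auto simp: gapped_def simp flip: zero_enat_def)
    qed
    finally show ?thesis .
  qed
  moreover have "forces (\<le>) v (enat n) (Circ A) \<longleftrightarrow> (\<forall>m<n. forces (\<le>) v (enat m) A)" for n
    by (auto simp: not_le le_enat_iff)
  ultimately show ?case using INF Circ unfolding eq by simp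
next
  case (Forall p A)
  have upd: "(\<lambda>q. V_enum (v q))(p := V_enum w) = (\<lambda>q. V_enum ((v(p := w)) q))" for w by auto
  have eq: "eval (\<lambda>q. V_enum (v q)) (Forall p A) = (INF w. eval (\<lambda>q. V_enum ((v(p := w)) q)) A)"
    by (simp add: V_up_eq_range image_image upd del: fun_upd_apply)
  show ?case unfolding eq using gapped_INF[of "\<lambda>w. eval (\<lambda>q. V_enum ((v(p := w)) q)) A"] Forall.IH
    by (simp del: fun_upd_apply)
next
  case (Exists p A)
  have upd: "(\<lambda>q. V_enum (v q))(p := V_enum w) = (\<lambda>q. V_enum ((v(p := w)) q))" for w by auto
  have eq: "eval (\<lambda>q. V_enum (v q)) (Exists p A) = (SUP w. eval (\<lambda>q. V_enum ((v(p := w)) q)) A)"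
    by (simp add: V_up_eq_range image_image upd del: fun_upd_apply)
  show ?case unfolding eq using gapped_SUP[of "\<lambda>w. eval (\<lambda>q. V_enum ((v(p := w)) q)) A"] Exists.IH
    by (simp del: fun_upd_apply)
qed

section \<open>Renaming of variables\<close>

primrec vars :: "fm \<Rightarrow> var set" where
  "vars (Atom q) = {q}"
| "vars Bot = {}"
| "vars Top = {}"
| "vars (A \<^bold>\<and> B) = vars A \<union> vars B"
| "vars (A \<^bold>\<or> B) = vars A \<union> vars B"
| "vars (A \<^bold>\<supset> B) = vars A \<union> vars B"
| "vars (Circ A) = vars A"
| "vars (Forall q A) = insert q (vars A)"
| "vars (Exists q A) = insert q (vars A)"

lemma finite_vars [simp]: "finite (vars A)"
  by (induction A) auto

lemma fv_subset_vars: "fv A \<subseteq> vars A"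
  by (induction A) auto

lemma not_in_fv: "q \<notin> vars A \<Longrightarrow> q \<notin> fv A"
  using fv_subset_vars by blast

lemma fresh_var:
  obtains q where "q \<ge> m" "q \<notin> vars A"
proof -
  have "finite ({..<m} \<union> vars A)" by simp
  then obtain q where "q \<notin> {..<m} \<union> vars A" using ex_new_if_finite[OF infinite_UNIV_nat] by blast
  then show thesis using that[of q] by auto
qed

lemma subst_fresh [simp]: "p \<notin> fv A \<Longrightarrow> subst p X A = A"
  by (induction A) auto

lemma subst_Atom_same [simp]: "subst p (Atom p) A = A"
  by (induction A) auto

lemma free_for_fresh [simp]: "p \<notin> fv A \<Longrightarrow> free_for p X A"
  by (induction A) auto

lemma free_for_Atom: "q \<notin> vars A \<Longrightarrow> free_for p (Atom q) A"
  by (induction A) auto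

lemma free_for_Atom_same: "free_for p (Atom p) A"
  by (induction A) auto

lemma fv_subst_Atom: "fv (subst p (Atom q) A) \<subseteq> insert q (fv A - {p})"
  by (induction A) auto

lemma size_subst_Atom [simp]: "size (subst p (Atom q) A) = size A"
  by (induction A) auto

lemma subst_Atom_back: "q \<notin> vars A \<Longrightarrow> subst q (Atom p) (subst p (Atom q) A) = A"
  by (induction A) (auto simp: not_in_fv)

lemma free_for_back: "q \<notin> vars A \<Longrightarrow> free_for q (Atom p) (subst p (Atom q) A)"
  by (induction A) (auto simp: not_in_fv)

text \<open>Variables suffice as substituted formulas, since \<open>name\<close> will replace any
  formula by an equivalent variable.\<close>

lemma forces_subst:
  "q \<notin> vars A \<Longrightarrow> forces le f y (subst p (Atom q) A) \<longleftrightarrow> forces le (f(p := f q)) y A"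
proof (induction A arbitrary: f y)
  case (Forall r A)
  then have "(f(r := c))(p := (f(r := c)) q) = (f(p := f q))(r := c)" if "r \<noteq> p" for c
    using that by auto
  then show ?case using Forall by (cases "r = p") (simp_all del: fun_upd_apply add: fun_upd_upd)
next
  case (Exists r A)
  then have "(f(r := c))(p := (f(r := c)) q) = (f(p := f q))(r := c)" if "r \<noteq> p" for c
    using that by auto
  then show ?case using Exists by (cases "r = p") (simp_all del: fun_upd_apply add: fun_upd_upd)
qed auto

section \<open>Theories\<close>

lemma derivable_Top: "\<turnstile> Top"
  by (rule MP[OF I1 I10])

text \<open>Closure under the quantifier rules is not imposed: a theory with witnesses treats its
  variables as constants, over which one must not generalise. The derivable formulas form an
  instance, so the same lemmas serve inside the calculus.\<close>

locale theory_of =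
  fixes T :: "fm set"
  assumes ax: "\<turnstile> A \<Longrightarrow> A \<in> T"
    and mp: "A \<in> T \<Longrightarrow> (A \<^bold>\<supset> B) \<in> T \<Longrightarrow> B \<in> T"
begin

abbreviation entails (infix "\<sqsubseteq>" 50) where "A \<sqsubseteq> B \<equiv> (A \<^bold>\<supset> B) \<in> T"

lemma weaken: "B \<in> T \<Longrightarrow> A \<sqsubseteq> B"
  using mp[OF _ ax[OF I1]] .

lemma imp_S: "A \<sqsubseteq> (B \<^bold>\<supset> C) \<Longrightarrow> A \<sqsubseteq> B \<Longrightarrow> A \<sqsubseteq> C"
  using mp[OF _ mp[OF _ ax[OF I11]]] by blast

lemma ent_refl: "A \<sqsubseteq> A"
  using imp_S[OF ax[OF I1] ax[OF I1]] .

lemma ent_trans: "A \<sqsubseteq> B \<Longrightarrow> B \<sqsubseteq> C \<Longrightarrow> A \<sqsubseteq> C"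
  using imp_S[OF weaken] .

lemma and_left: "(A \<^bold>\<and> B) \<sqsubseteq> A" and and_right: "(A \<^bold>\<and> B) \<sqsubseteq> B"
  by (simp_all add: ax I2 I3)

lemma and_greatest: "X \<sqsubseteq> A \<Longrightarrow> X \<sqsubseteq> B \<Longrightarrow> X \<sqsubseteq> (A \<^bold>\<and> B)"
  using imp_S[OF ent_trans[OF _ ax[OF I4]]] .

lemma or_left: "A \<sqsubseteq> (A \<^bold>\<or> B)" and or_right: "B \<sqsubseteq> (A \<^bold>\<or> B)"
  by (simp_all add: ax I5 I6)

lemma conj: "(A \<^bold>\<and> B) \<in> T \<longleftrightarrow> A \<in> T \<and> B \<in> T"
  using mp[OF _ and_left] mp[OF _ and_right] mp[OF _ mp[OF _ ax[OF I4]]] by blast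

lemma or_least: "A \<sqsubseteq> C \<Longrightarrow> B \<sqsubseteq> C \<Longrightarrow> (A \<^bold>\<or> B) \<sqsubseteq> C"
  using mp[OF _ ax[OF I12]] conj by blast

lemma residuation: "(A \<^bold>\<and> B) \<sqsubseteq> C \<longleftrightarrow> A \<sqsubseteq> (B \<^bold>\<supset> C)"
proof
  assume "(A \<^bold>\<and> B) \<sqsubseteq> C"
  then have "B \<sqsubseteq> ((A \<^bold>\<and> B) \<^bold>\<supset> C)" by (rule weaken)
  then have "(B \<^bold>\<supset> (A \<^bold>\<and> B)) \<sqsubseteq> (B \<^bold>\<supset> C)" by (rule mp[OF _ ax[OF I11]])
  then show "A \<sqsubseteq> (B \<^bold>\<supset> C)" by (rule ent_trans[OF ax[OF I4]])
next
  assume "A \<sqsubseteq> (B \<^bold>\<supset> C)"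
  then show "(A \<^bold>\<and> B) \<sqsubseteq> C" by (rule imp_S[OF ent_trans[OF and_left] and_right])
qed

lemma and_commute: "(A \<^bold>\<and> B) \<sqsubseteq> (B \<^bold>\<and> A)"
  by (rule and_greatest[OF and_right and_left])

lemma cut:
  assumes "C \<sqsubseteq> (A \<^bold>\<or> D)" "(C \<^bold>\<and> A) \<sqsubseteq> D"
  shows "C \<sqsubseteq> D"
proof -
  have "A \<sqsubseteq> (C \<^bold>\<supset> D)" using assms(2) ent_trans[OF and_commute] residuation by blast
  moreover have "D \<sqsubseteq> (C \<^bold>\<supset> D)" by (simp add: ax I1)
  ultimately have "(A \<^bold>\<or> D) \<sqsubseteq> (C \<^bold>\<supset> D)" by (rule or_least)
  then have "C \<sqsubseteq> (C \<^bold>\<supset> D)" using ent_trans[OF assms(1)] by blast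
  then show ?thesis by (rule imp_S[OF _ ent_refl])
qed

lemma ex_intro: "free_for p C A \<Longrightarrow> subst p C A \<sqsubseteq> Exists p A"
  and all_elim: "free_for p C A \<Longrightarrow> Forall p A \<sqsubseteq> subst p C A"
  by (simp_all add: ax Exists_intro Forall_elim)

end

section \<open>Quantifier laws of the calculus\<close>

interpretation Derivable: theory_of "{A. \<turnstile> A}"
  by unfold_locales (auto intro: MP)

lemma rename_Exists:
  assumes "q \<notin> vars (Exists p A)"
  shows "\<turnstile> Exists p A \<^bold>\<supset> Exists q (subst p (Atom q) A)"
proof (rule Exists_rule)
  show "\<turnstile> A \<^bold>\<supset> Exists q (subst p (Atom q) A)"
    using Exists_intro[OF free_for_back[of q A p]] assms by (simp add: subst_Atom_back)
  show "p \<notin> fv (Exists q (subst p (Atom q) A))" using fv_subst_Atom[of p q A] assms by auto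
qed

lemma rename_Forall:
  assumes "q \<notin> vars (Forall p A)"
  shows "\<turnstile> Forall q (subst p (Atom q) A) \<^bold>\<supset> Forall p A"
proof (rule Forall_rule)
  show "\<turnstile> Forall q (subst p (Atom q) A) \<^bold>\<supset> A"
    using Forall_elim[OF free_for_back[of q A p]] assms by (simp add: subst_Atom_back)
  show "p \<notin> fv (Forall q (subst p (Atom q) A))" using fv_subst_Atom[of p q A] assms by auto
qed

lemma Forall_imp:
  assumes "p \<notin> fv C"
  shows "\<turnstile> Forall p (C \<^bold>\<supset> A) \<^bold>\<supset> (C \<^bold>\<supset> Forall p A)"
proof -
  have "\<turnstile> Forall p (C \<^bold>\<supset> A) \<^bold>\<supset> (C \<^bold>\<supset> A)"
    using Forall_elim[OF free_for_Atom_same[of p "C \<^bold>\<supset> A"]] by simp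
  then have "\<turnstile> (Forall p (C \<^bold>\<supset> A) \<^bold>\<and> C) \<^bold>\<supset> A" using Derivable.residuation by simp
  then have "\<turnstile> (Forall p (C \<^bold>\<supset> A) \<^bold>\<and> C) \<^bold>\<supset> Forall p A" using assms by (intro Forall_rule) auto
  then show ?thesis using Derivable.residuation by simp
qed

lemma Exists_imp:
  assumes "p \<notin> fv C"
  shows "\<turnstile> Forall p (A \<^bold>\<supset> C) \<^bold>\<supset> (Exists p A \<^bold>\<supset> C)"
proof -
  have "\<turnstile> Forall p (A \<^bold>\<supset> C) \<^bold>\<supset> (A \<^bold>\<supset> C)"
    using Forall_elim[OF free_for_Atom_same[of p "A \<^bold>\<supset> C"]] by simp
  then have "\<turnstile> (A \<^bold>\<and> Forall p (A \<^bold>\<supset> C)) \<^bold>\<supset> C"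
    using Derivable.residuation Derivable.ent_trans[OF Derivable.and_commute] by simp
  then have "\<turnstile> A \<^bold>\<supset> (Forall p (A \<^bold>\<supset> C) \<^bold>\<supset> C)" using Derivable.residuation by simp
  then have "\<turnstile> Exists p A \<^bold>\<supset> (Forall p (A \<^bold>\<supset> C) \<^bold>\<supset> C)" using assms by (intro Exists_rule) auto
  then have "\<turnstile> (Forall p (A \<^bold>\<supset> C) \<^bold>\<and> Exists p A) \<^bold>\<supset> C"
    using Derivable.residuation Derivable.ent_trans[OF Derivable.and_commute] by simp
  then show ?thesis using Derivable.residuation by simp
qed

text \<open>Finitely many formulas leave infinitely many variables fresh, so variables act as
  witnesses and the language is not extended.\<close>

lemma Exists_witness:
  assumes "\<turnstile> (C \<^bold>\<and> subst p (Atom q) A) \<^bold>\<supset> D"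
    and "q \<notin> vars (Exists p A)" "q \<notin> fv C" "q \<notin> fv D"
  shows "\<turnstile> (C \<^bold>\<and> Exists p A) \<^bold>\<supset> D"
proof -
  have "\<turnstile> subst p (Atom q) A \<^bold>\<supset> (C \<^bold>\<supset> D)"
    using assms(1) Derivable.residuation Derivable.ent_trans[OF Derivable.and_commute] by simp
  then have "\<turnstile> Exists q (subst p (Atom q) A) \<^bold>\<supset> (C \<^bold>\<supset> D)"
    using assms by (intro Exists_rule) auto
  then have "\<turnstile> Exists p A \<^bold>\<supset> (C \<^bold>\<supset> D)"
    using Derivable.ent_trans rename_Exists[OF assms(2)] by simp
  then show ?thesis using Derivable.residuation Derivable.ent_trans[OF Derivable.and_commute] by simp
qed

text \<open>\<open>Forall_shift\<close> lets the quantifier pass the disjunct \<open>D\<close>,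
  which will collect the formulas kept out of a theory.\<close>

lemma Forall_witness:
  assumes "\<turnstile> C \<^bold>\<supset> (D \<^bold>\<or> subst p (Atom q) A)"
    and "q \<notin> vars (Forall p A)" "q \<notin> fv C" "q \<notin> fv D"
  shows "\<turnstile> C \<^bold>\<supset> (D \<^bold>\<or> Forall p A)"
proof -
  have "\<turnstile> C \<^bold>\<supset> Forall q (D \<^bold>\<or> subst p (Atom q) A)"
    using assms by (intro Forall_rule) auto
  then have "\<turnstile> C \<^bold>\<supset> (D \<^bold>\<or> Forall q (subst p (Atom q) A))"
    using Derivable.ent_trans Forall_shift[OF assms(4)] by simp
  moreover have "\<turnstile> (D \<^bold>\<or> Forall q (subst p (Atom q) A)) \<^bold>\<supset> (D \<^bold>\<or> Forall p A)"
    using Derivable.or_least Derivable.or_left Derivable.ent_trans[OF _ Derivable.or_right]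
      rename_Forall[OF assms(2)] by simp
  ultimately show ?thesis using Derivable.ent_trans by simp
qed

section \<open>Henkin theories\<close>

instance fm :: countable
  by countable_datatype

text \<open>The bound \<open>m\<close> provides witnesses among arbitrarily large variables, so that
  any finite set of variables can be avoided and capture does not occur.\<close>

locale henkin = theory_of T for T +
  assumes prime: "(A \<^bold>\<or> B) \<in> T \<Longrightarrow> A \<in> T \<or> B \<in> T"
    and ex_witness: "Exists p A \<in> T \<Longrightarrow> \<exists>q\<ge>m. q \<notin> vars (Exists p A) \<and> subst p (Atom q) A \<in> T"
    and all_witness: "Forall p A \<notin> T \<Longrightarrow> \<exists>q\<ge>m. q \<notin> vars (Forall p A) \<and> subst p (Atom q) A \<notin> T"

text \<open>The pair \<open>(C, D)\<close> stands for the formulas already put into the theory (their conjunction) and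
  those kept out of it (their disjunction).\<close>

definition decides :: "fm \<Rightarrow> nat \<Rightarrow> fm \<Rightarrow> fm \<Rightarrow> bool" where
  "decides F m C D \<longleftrightarrow>
    (\<turnstile> C \<^bold>\<supset> F) \<and> (\<forall>p A. F = Exists p A \<longrightarrow>
      (\<exists>q\<ge>m. q \<notin> vars F \<and> (\<turnstile> C \<^bold>\<supset> subst p (Atom q) A))) \<or>
    (\<turnstile> F \<^bold>\<supset> D) \<and> (\<forall>p A. F = Forall p A \<longrightarrow>
      (\<exists>q\<ge>m. q \<notin> vars F \<and> (\<turnstile> subst p (Atom q) A \<^bold>\<supset> D)))"

text \<open>If \<open>C\<close> entails the disjunction of \<open>F\<close> and \<open>D\<close>,
  then \<open>cut\<close> allows \<open>F\<close> to join \<open>C\<close>; otherwise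
  \<open>F\<close> can join \<open>D\<close>. An accepted existential or rejected universal formula
  receives its fresh instance at once.\<close>

lemma decide_step:
  assumes "\<not> (\<turnstile> C \<^bold>\<supset> D)"
  shows "\<exists>C' D'. (\<not> (\<turnstile> C' \<^bold>\<supset> D')) \<and> (\<turnstile> C' \<^bold>\<supset> C) \<and> (\<turnstile> D \<^bold>\<supset> D') \<and> decides F m C' D'"
proof (cases "\<turnstile> C \<^bold>\<supset> (F \<^bold>\<or> D)")
  case True
  have F: "\<not> (\<turnstile> (C \<^bold>\<and> F) \<^bold>\<supset> D)" using Derivable.cut[of C F D] True assms by auto
  show ?thesis
  proof (cases "\<exists>p A. F = Exists p A")
    case True
    then obtain p A where [simp]: "F = Exists p A" by blast
    obtain q where q: "q \<ge> m" "q \<notin> vars ((C \<^bold>\<and> F) \<^bold>\<and> D)" by (rule fresh_var)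
    let ?C = "(C \<^bold>\<and> F) \<^bold>\<and> subst p (Atom q) A"
    have "\<not> (\<turnstile> ?C \<^bold>\<supset> D)"
    proof
      assume "\<turnstile> ?C \<^bold>\<supset> D"
      moreover have "q \<notin> fv (C \<^bold>\<and> F)" "q \<notin> fv D"
        using q fv_subset_vars[of "C \<^bold>\<and> F"] fv_subset_vars[of D] by auto
      ultimately have "\<turnstile> ((C \<^bold>\<and> F) \<^bold>\<and> Exists p A) \<^bold>\<supset> D"
        using q by (intro Exists_witness[of "C \<^bold>\<and> F" p q A D]) auto
      moreover have "\<turnstile> (C \<^bold>\<and> F) \<^bold>\<supset> ((C \<^bold>\<and> F) \<^bold>\<and> Exists p A)"
        using Derivable.and_greatest Derivable.ent_refl Derivable.and_right by simp
      ultimately show False using F Derivable.ent_trans by simp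
    qed
    moreover have "\<turnstile> ?C \<^bold>\<supset> C" "\<turnstile> ?C \<^bold>\<supset> F" "\<turnstile> ?C \<^bold>\<supset> subst p (Atom q) A"
      using Derivable.ent_trans[OF Derivable.and_left Derivable.and_left]
        Derivable.ent_trans[OF Derivable.and_left Derivable.and_right]
        Derivable.and_right by simp_all
    moreover have "\<turnstile> D \<^bold>\<supset> D" using Derivable.ent_refl by simp
    ultimately show ?thesis using q unfolding decides_def by fastforce
  next
    case False
    moreover have "\<turnstile> (C \<^bold>\<and> F) \<^bold>\<supset> C" "\<turnstile> (C \<^bold>\<and> F) \<^bold>\<supset> F" "\<turnstile> D \<^bold>\<supset> D"
      using Derivable.and_left Derivable.and_right Derivable.ent_refl by simp_all
    ultimately show ?thesis using F unfolding decides_def by blast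
  qed
next
  case F: False
  show ?thesis
  proof (cases "\<exists>p A. F = Forall p A")
    case True
    then obtain p A where [simp]: "F = Forall p A" by blast
    obtain q where q: "q \<ge> m" "q \<notin> vars (C \<^bold>\<and> (F \<^bold>\<or> D))" by (rule fresh_var)
    let ?D = "(F \<^bold>\<or> D) \<^bold>\<or> subst p (Atom q) A"
    have "\<not> (\<turnstile> C \<^bold>\<supset> ?D)"
    proof
      assume "\<turnstile> C \<^bold>\<supset> ?D"
      moreover have "q \<notin> fv (F \<^bold>\<or> D)" "q \<notin> fv C"
        using q fv_subset_vars[of "F \<^bold>\<or> D"] fv_subset_vars[of C] by auto
      ultimately have "\<turnstile> C \<^bold>\<supset> ((F \<^bold>\<or> D) \<^bold>\<or> Forall p A)"
        using q by (intro Forall_witness[of C "F \<^bold>\<or> D" p q A]) auto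
      moreover have "\<turnstile> ((F \<^bold>\<or> D) \<^bold>\<or> Forall p A) \<^bold>\<supset> (F \<^bold>\<or> D)"
        using Derivable.or_least Derivable.ent_refl Derivable.or_left by simp
      ultimately show False using F Derivable.ent_trans by simp
    qed
    moreover have "\<turnstile> D \<^bold>\<supset> ?D" "\<turnstile> F \<^bold>\<supset> ?D" "\<turnstile> subst p (Atom q) A \<^bold>\<supset> ?D"
      using Derivable.ent_trans[OF Derivable.or_right Derivable.or_left]
        Derivable.ent_trans[OF Derivable.or_left Derivable.or_left]
        Derivable.or_right by simp_all
    moreover have "\<turnstile> C \<^bold>\<supset> C" using Derivable.ent_refl by simp
    ultimately show ?thesis using q unfolding decides_def by fastforce
  next
    case False
    moreover have "\<turnstile> D \<^bold>\<supset> (F \<^bold>\<or> D)" "\<turnstile> F \<^bold>\<supset> (F \<^bold>\<or> D)" "\<turnstile> C \<^bold>\<supset> C"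
      using Derivable.or_left Derivable.or_right Derivable.ent_refl by simp_all
    ultimately show ?thesis using F unfolding decides_def by blast
  qed
qed

lemma henkin_extension:
  assumes "\<not> (\<turnstile> A)"
  obtains T where "henkin T" "A \<notin> T"
proof -
  let ?P = "\<lambda>n (C, D). (\<not> (\<turnstile> C \<^bold>\<supset> D)) \<and> (n = 0 \<longrightarrow> D = A)"
  \<comment> \<open>A stage number codes a formula together with a bound, so each formula is treated
    for every bound \<open>m\<close>.\<close>
  let ?Q = "\<lambda>n (C, D) (C', D'). (\<turnstile> C' \<^bold>\<supset> C) \<and> (\<turnstile> D \<^bold>\<supset> D') \<and>
    (case from_nat n of (F, m) \<Rightarrow> decides F m C' D')"
  have "\<not> (\<turnstile> Top \<^bold>\<supset> A)"
  proof
    assume "\<turnstile> Top \<^bold>\<supset> A"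
    then show False using MP[OF derivable_Top] assms by blast
  qed
  then have P0: "\<exists>x. ?P 0 x" by auto
  have PS: "\<exists>y. ?P (Suc n) y \<and> ?Q n x y" if "?P n x" for n x
  proof -
    obtain C D where [simp]: "x = (C, D)" by (cases x)
    obtain F :: fm and m :: nat where Fm: "from_nat n = (F, m)" using prod.exhaust by blast
    have "\<not> (\<turnstile> C \<^bold>\<supset> D)" using that by simp
    from decide_step[OF this, of F m] obtain C' D' where
      "(\<not> (\<turnstile> C' \<^bold>\<supset> D')) \<and> (\<turnstile> C' \<^bold>\<supset> C) \<and> (\<turnstile> D \<^bold>\<supset> D') \<and> decides F m C' D'" by blast
    then have "?P (Suc n) (C', D') \<and> ?Q n x (C', D')" by (simp add: Fm)
    then show ?thesis by (rule exI)
  qed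
  obtain h where h: "\<forall>n. ?P n (h n) \<and> ?Q n (h n) (h (Suc n))"
    using dependent_nat_choice[of ?P ?Q, OF P0 PS] by (rule exE)
  define C where "C n = fst (h n)" for n
  define D where "D n = snd (h n)" for n
  have CD: "\<not> (\<turnstile> C n \<^bold>\<supset> D n)" "D 0 = A" for n
    using h[rule_format, of n] h[rule_format, of 0] by (auto simp: C_def D_def split: prod.splits)
  have C_step: "\<turnstile> C (Suc n) \<^bold>\<supset> C n" and D_step: "\<turnstile> D n \<^bold>\<supset> D (Suc n)" for n
    using h[rule_format, of n] by (auto simp: C_def D_def split: prod.splits)
  have "decides F m (C (Suc (to_nat (F, m)))) (D (Suc (to_nat (F, m))))" for F m
    using h[rule_format, of "to_nat (F, m)"] by (auto simp: C_def D_def split: prod.splits)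
  then have dec: "\<exists>n. decides F m (C n) (D n)" for F m by (rule exI)
  note refl = Derivable.ent_refl[unfolded mem_Collect_eq] and trans = Derivable.ent_trans[unfolded mem_Collect_eq]
  have C_mono: "\<turnstile> C n \<^bold>\<supset> C k" if "k \<le> n" for n k
    using that by (induction rule: dec_induct) (auto intro: refl trans[OF C_step])
  have D_mono: "\<turnstile> D k \<^bold>\<supset> D n" if "k \<le> n" for n k
    using that by (induction rule: dec_induct) (auto intro: refl trans[OF _ D_step])
  define T where "T = {F. \<exists>n. \<turnstile> C n \<^bold>\<supset> F}"
  have C_up: "\<turnstile> C k \<^bold>\<supset> F" if "\<turnstile> C n \<^bold>\<supset> F" "n \<le> k" for n k F
    using trans[OF C_mono] that by blast
  have D_up: "\<turnstile> F \<^bold>\<supset> D k" if "\<turnstile> F \<^bold>\<supset> D n" "n \<le> k" for n k F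
    using trans[OF _ D_mono] that by blast
  have notin: "F \<notin> T" if "\<turnstile> F \<^bold>\<supset> D n" for F n
  proof
    assume "F \<in> T"
    then obtain k where "\<turnstile> C k \<^bold>\<supset> F" unfolding T_def by blast
    then have "\<turnstile> C (max n k) \<^bold>\<supset> D (max n k)"
      using trans[OF C_up[of k F "max n k"] D_up[OF that, of "max n k"]] by simp
    then show False using CD by blast
  qed
  have out: "\<exists>n. \<turnstile> F \<^bold>\<supset> D n" if "F \<notin> T" for F
    using dec[of F 0] that unfolding decides_def T_def by blast
  have "henkin T"
  proof
    fix F assume "\<turnstile> F"
    then have "\<turnstile> C 0 \<^bold>\<supset> F" using Derivable.weaken by simp
    then show "F \<in> T" unfolding T_def by blast
  next
    fix F G assume "F \<in> T" "(F \<^bold>\<supset> G) \<in> T"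
    then obtain n k where "\<turnstile> C n \<^bold>\<supset> F" "\<turnstile> C k \<^bold>\<supset> (F \<^bold>\<supset> G)" unfolding T_def by blast
    then have "\<turnstile> C (max n k) \<^bold>\<supset> G"
      using C_up[of n F "max n k"] C_up[of k _ "max n k"] Derivable.imp_S[of _ F G] by simp
    then show "G \<in> T" unfolding T_def by blast
  next
    fix F G assume FG: "(F \<^bold>\<or> G) \<in> T"
    show "F \<in> T \<or> G \<in> T"
    proof (rule ccontr)
      assume "\<not> ?thesis"
      then obtain n k where "\<turnstile> F \<^bold>\<supset> D n" "\<turnstile> G \<^bold>\<supset> D k" using out by blast
      then have "\<turnstile> (F \<^bold>\<or> G) \<^bold>\<supset> D (max n k)"
        using Derivable.or_least D_up[of F n "max n k"] D_up[of G k "max n k"] by simp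
      then show False using notin FG by blast
    qed
  next
    fix p F m assume F: "Exists p F \<in> T"
    then show "\<exists>q\<ge>m. q \<notin> vars (Exists p F) \<and> subst p (Atom q) F \<in> T"
      using dec[of "Exists p F" m] notin unfolding decides_def T_def by blast
  next
    fix p F m assume F: "Forall p F \<notin> T"
    then show "\<exists>q\<ge>m. q \<notin> vars (Forall p F) \<and> subst p (Atom q) F \<notin> T"
      using dec[of "Forall p F" m] notin unfolding decides_def T_def by blast
  qed
  moreover have "A \<notin> T" using notin[of A 0] CD(2) Derivable.ent_refl by simp
  ultimately show thesis by (rule that)
qed

section \<open>The chain of a Henkin theory\<close>

context henkin
begin

text \<open>Instantiating \<open>Exists p (Iff C (Atom p))\<close> at \<open>C\<close> itself is
  trivial, so the formula is in \<open>T\<close> and its witness names \<open>C\<close>.\<close>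

lemma name:
  obtains q where "q \<ge> m" "C \<sqsubseteq> Atom q" "Atom q \<sqsubseteq> C"
proof -
  obtain p where p: "p \<ge> 0" "p \<notin> vars C" by (rule fresh_var)
  then have [simp]: "p \<notin> fv C" using fv_subset_vars by blast
  have "subst p C (C \<^bold>\<leftrightarrow> Atom p) \<sqsubseteq> Exists p (C \<^bold>\<leftrightarrow> Atom p)" by (rule ex_intro) simp
  then have "Exists p (C \<^bold>\<leftrightarrow> Atom p) \<in> T" by (rule mp[rotated]) (simp add: conj ent_refl)
  from ex_witness[OF this, of m] show thesis using that conj by auto
qed

text \<open>In (G4) the premise becomes the identity on \<open>Circ A\<close>; the conclusion leaves
  nothing strictly between \<open>A\<close> and \<open>Circ A\<close>.\<close>

lemma suc_le_or: "Circ A \<sqsubseteq> B \<or> B \<sqsubseteq> A"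
  by (rule prime[OF mp[OF ent_refl ax[OF G4]]])

sublocale discrete_chain "(\<sqsubseteq>)" Circ Bot
proof
  fix A B
  show "A \<sqsubseteq> Circ A" using ax[OF G2] conj by blast
  show "\<not> B \<sqsubseteq> A \<Longrightarrow> Circ A \<sqsubseteq> B" using suc_le_or by blast
  show "B \<sqsubseteq> A" if "Circ A \<sqsubseteq> A"
  proof -
    \<comment> \<open>The second half of (G2) puts \<open>A\<close> into \<open>T\<close>, and
      members of \<open>T\<close> are greatest.\<close>
    have "(Circ A \<^bold>\<supset> A) \<sqsubseteq> A" using ax[OF G2] conj by blast
    then show ?thesis by (rule weaken[OF mp[OF that]])
  qed
  show "A \<sqsubseteq> Bot \<or> (\<exists>q. Circ q \<sqsubseteq> A \<and> A \<sqsubseteq> Circ q)"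
  proof -
    obtain p where p: "p \<ge> 0" "p \<notin> vars A" by (rule fresh_var)
    then have [simp]: "p \<notin> fv A" using fv_subset_vars by blast
    have "(A \<^bold>\<leftrightarrow> Bot) \<in> T \<or> Exists p (A \<^bold>\<leftrightarrow> Circ (Atom p)) \<in> T"
      using prime ax[OF G5] by simp
    then show ?thesis
    proof
      assume "Exists p (A \<^bold>\<leftrightarrow> Circ (Atom p)) \<in> T"
      from ex_witness[OF this, of 0] show ?thesis using conj by auto
    qed (simp add: conj)
  qed
qed (auto intro: ent_refl ent_trans ax I9)

lemma ent_total: "A \<sqsubseteq> B \<or> B \<sqsubseteq> A"
  by (rule prime[OF ax[OF LC]])

lemma forces_cong:
  assumes "\<And>p. f p \<sqsubseteq> g p" "\<And>p. g p \<sqsubseteq> f p"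
  shows "forces (\<sqsubseteq>) f y A \<longleftrightarrow> forces (\<sqsubseteq>) g y A"
  using assms
proof (induction A arbitrary: f g y)
  case (Atom q)
  then show ?case using ent_trans[OF Atom(1)] ent_trans[OF Atom(2)] by auto
next
  case (Forall q A)
  have "forces (\<sqsubseteq>) (f(q := c)) y A \<longleftrightarrow> forces (\<sqsubseteq>) (g(q := c)) y A" for c
    by (rule Forall.IH) (use Forall.prems ent_refl in auto)
  then show ?case by simp
next
  case (Exists q A)
  have "forces (\<sqsubseteq>) (f(q := c)) y A \<longleftrightarrow> forces (\<sqsubseteq>) (g(q := c)) y A" for c
    by (rule Exists.IH) (use Exists.prems ent_refl in auto)
  then show ?case by simp
next
  case (And A B)
  show ?case by (simp add: And.IH[OF And.prems])
next
  case (Or A B)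
  show ?case by (simp add: Or.IH[OF Or.prems])
next
  case (Imp A B)
  show ?case by (simp add: Imp.IH[OF Imp.prems])
next
  case (Circ A)
  show ?case by (simp add: Circ.IH[OF Circ.prems])
qed simp_all

text \<open>\<open>all_witness\<close> is about membership in \<open>T\<close>, not about being at
  most \<open>y\<close>, so the bound is moved under the quantifier as the antecedent
  \<open>Circ y\<close>. The successor turns "strictly above \<open>y\<close>" into a lower bound,
  which the infimum inherits.\<close>

lemma Forall_not_le_iff:
  assumes y: "y \<notin> T"
  shows "\<not> Forall p A \<sqsubseteq> y \<longleftrightarrow> (\<forall>q\<ge>m. q \<notin> vars (Forall p A) \<longrightarrow> \<not> subst p (Atom q) A \<sqsubseteq> y)"
proof
  assume "\<not> Forall p A \<sqsubseteq> y"
  then show "\<forall>q\<ge>m. q \<notin> vars (Forall p A) \<longrightarrow> \<not> subst p (Atom q) A \<sqsubseteq> y"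
    using ent_trans[OF all_elim[OF free_for_Atom]] by simp blast
next
  assume *: "\<forall>q\<ge>m. q \<notin> vars (Forall p A) \<longrightarrow> \<not> subst p (Atom q) A \<sqsubseteq> y"
  show "\<not> Forall p A \<sqsubseteq> y"
  proof
    assume le: "Forall p A \<sqsubseteq> y"
    \<comment> \<open>A name of \<open>y\<close> other than \<open>p\<close>, so that the quantifier
      does not bind it.\<close>
    obtain r where r: "r \<ge> Suc p" "y \<sqsubseteq> Atom r" "Atom r \<sqsubseteq> y" by (rule name)
    let ?C = "Circ (Atom r)"
    have "\<not> ?C \<sqsubseteq> Forall p A"
    proof
      assume "?C \<sqsubseteq> Forall p A"
      then have "?C \<sqsubseteq> Atom r" by (rule ent_trans[OF _ ent_trans[OF le r(2)]])
      then have "\<And>B. B \<sqsubseteq> y" by (rule ent_trans[OF suc_top r(3)])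
      then show False using y mp[OF ax[OF I10[of Top]]] ax I10 mp MP by (metis I1)
    qed
    moreover have "Forall p (?C \<^bold>\<supset> A) \<sqsubseteq> (?C \<^bold>\<supset> Forall p A)"
      using r(1) ax[OF Forall_imp[of p ?C A]] by simp
    ultimately have "Forall p (?C \<^bold>\<supset> A) \<notin> T" using mp[of "Forall p (?C \<^bold>\<supset> A)"] by blast
    from all_witness[OF this, of m] obtain q where
      q: "q \<ge> m" "q \<notin> vars (Forall p (?C \<^bold>\<supset> A))" "subst p (Atom q) (?C \<^bold>\<supset> A) \<notin> T" by blast
    have "\<not> ?C \<sqsubseteq> subst p (Atom q) A" using q(3) r(1) by simp
    then have "subst p (Atom q) A \<sqsubseteq> Atom r" using suc_le by blast
    then have "subst p (Atom q) A \<sqsubseteq> y" by (rule ent_trans[OF _ r(3)])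
    then show False using * q by auto
  qed
qed

lemma Exists_not_le_iff:
  "\<not> Exists p A \<sqsubseteq> y \<longleftrightarrow> (\<exists>q\<ge>m. q \<notin> vars (Exists p A) \<and> \<not> subst p (Atom q) A \<sqsubseteq> y)"
proof
  assume "\<exists>q\<ge>m. q \<notin> vars (Exists p A) \<and> \<not> subst p (Atom q) A \<sqsubseteq> y"
  then show "\<not> Exists p A \<sqsubseteq> y"
    using ent_trans[OF ex_intro[OF free_for_Atom]] by auto
next
  assume le: "\<not> Exists p A \<sqsubseteq> y"
  obtain r where r: "r \<ge> Suc p" "y \<sqsubseteq> Atom r" "Atom r \<sqsubseteq> y" by (rule name)
  have "\<not> Exists p A \<sqsubseteq> Atom r" using le ent_trans[OF _ r(3)] by blast
  moreover have "Forall p (A \<^bold>\<supset> Atom r) \<sqsubseteq> (Exists p A \<^bold>\<supset> Atom r)"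
    using r(1) ax[OF Exists_imp[of p "Atom r" A]] by simp
  ultimately have "Forall p (A \<^bold>\<supset> Atom r) \<notin> T" using mp[of "Forall p (A \<^bold>\<supset> Atom r)"] by blast
  from all_witness[OF this, of m] obtain q where
    q: "q \<ge> m" "q \<notin> vars (Forall p (A \<^bold>\<supset> Atom r))" "subst p (Atom q) (A \<^bold>\<supset> Atom r) \<notin> T" by blast
  have "\<not> subst p (Atom q) A \<sqsubseteq> Atom r" using q(3) r(1) by (simp split: if_splits)
  then have "\<not> subst p (Atom q) A \<sqsubseteq> y" using ent_trans[OF _ r(2)] by blast
  then show "\<exists>q\<ge>m. q \<notin> vars (Exists p A) \<and> \<not> subst p (Atom q) A \<sqsubseteq> y" using q by auto
qed

lemma top_iff: "A \<in> T \<longleftrightarrow> Circ A \<sqsubseteq> A"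
  using weaken mp[OF ax[OF derivable_Top] suc_top] by blast

text \<open>Induction is on size because an instance by a variable has the size of the body. Worlds
  below \<open>y\<close> stay outside \<open>T\<close>, so the induction hypothesis applies to
  them.\<close>

theorem truth: "y \<notin> T \<Longrightarrow> forces (\<sqsubseteq>) Atom y A \<longleftrightarrow> \<not> A \<sqsubseteq> y"
proof (induction A arbitrary: y rule: measure_induct_rule[of size])
  case (less A)
  have below: "z \<notin> T" if "z \<sqsubseteq> y" for z using less.prems mp[OF _ that] by blast
  \<comment> \<open>The value \<open>c\<close> is an arbitrary formula; its name \<open>q\<close>
    turns the change of valuation into a substitution.\<close>
  have bound: "forces (\<sqsubseteq>) (Atom(p := c)) y B \<longleftrightarrow> \<not> subst p (Atom q) B \<sqsubseteq> y"
    if "size B < size A" "c \<sqsubseteq> Atom q" "Atom q \<sqsubseteq> c" "q \<notin> vars B" for p B c q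
  proof -
    have "forces (\<sqsubseteq>) (Atom(p := c)) y B \<longleftrightarrow> forces (\<sqsubseteq>) (Atom(p := Atom q)) y B"
      by (rule forces_cong) (use that ent_refl in auto)
    also have "\<dots> \<longleftrightarrow> forces (\<sqsubseteq>) Atom y (subst p (Atom q) B)" by (simp add: forces_subst that(4))
    also have "\<dots> \<longleftrightarrow> \<not> subst p (Atom q) B \<sqsubseteq> y" using that(1) by (intro less) simp_all
    finally show ?thesis .
  qed
  have fin: "\<exists>m. \<forall>q\<ge>m. q \<notin> vars B" for B
    using finite_nat_set_iff_bounded[of "vars B"] by (meson finite_vars not_less)
  show ?case
  proof (cases A)
    case (Atom q)
    then show ?thesis by simp
  next
    case Bot
    then show ?thesis using zero_least by simp
  next
    case Top
    have "\<not> Top \<sqsubseteq> y" using less.prems mp[OF ax[OF derivable_Top]] by blast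
    then show ?thesis using Top by simp
  next
    case (And B C)
    have "(B \<^bold>\<and> C) \<sqsubseteq> y \<longleftrightarrow> B \<sqsubseteq> y \<or> C \<sqsubseteq> y"
      using ent_total[of B C] ent_trans[OF and_greatest[OF ent_refl[of B]]]
        ent_trans[OF and_greatest[OF _ ent_refl[of C]]] ent_trans[OF and_left] ent_trans[OF and_right] by blast
    then show ?thesis using And less by simp
  next
    case (Or B C)
    have "(B \<^bold>\<or> C) \<sqsubseteq> y \<longleftrightarrow> B \<sqsubseteq> y \<and> C \<sqsubseteq> y"
      using or_least ent_trans[OF or_left] ent_trans[OF or_right] by blast
    then show ?thesis using Or less by simp
  next
    case (Imp B C)
    have IH: "forces (\<sqsubseteq>) Atom z B \<longleftrightarrow> \<not> B \<sqsubseteq> z" "forces (\<sqsubseteq>) Atom z C \<longleftrightarrow> \<not> C \<sqsubseteq> z" if "z \<sqsubseteq> y" for z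
      using less.IH below[OF that] Imp by simp_all
    have "(\<forall>z. z \<sqsubseteq> y \<longrightarrow> \<not> B \<sqsubseteq> z \<longrightarrow> \<not> C \<sqsubseteq> z) \<longleftrightarrow> \<not> (B \<^bold>\<supset> C) \<sqsubseteq> y"
    proof
      assume *: "\<forall>z. z \<sqsubseteq> y \<longrightarrow> \<not> B \<sqsubseteq> z \<longrightarrow> \<not> C \<sqsubseteq> z"
      show "\<not> (B \<^bold>\<supset> C) \<sqsubseteq> y"
      proof
        assume le: "(B \<^bold>\<supset> C) \<sqsubseteq> y"
        \<comment> \<open>The world \<open>C\<close> is the counterexample: it is below
          \<open>y\<close>, and being above \<open>B\<close> would put \<open>y\<close> into
          \<open>T\<close>.\<close>
        then have "\<not> B \<sqsubseteq> C" using mp[OF _ le] less.prems by blast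
        moreover have "C \<sqsubseteq> y" by (rule ent_trans[OF ax[OF I1] le])
        ultimately show False using * ent_refl by blast
      qed
    next
      assume *: "\<not> (B \<^bold>\<supset> C) \<sqsubseteq> y"
      have False if z: "z \<sqsubseteq> y" "\<not> B \<sqsubseteq> z" "C \<sqsubseteq> z" for z
      proof -
        have "((B \<^bold>\<supset> C) \<^bold>\<and> B) \<sqsubseteq> C" using residuation ent_refl by blast
        then have "((B \<^bold>\<supset> C) \<^bold>\<and> B) \<sqsubseteq> z" by (rule ent_trans[OF _ z(3)])
        then have "(B \<^bold>\<supset> C) \<sqsubseteq> z \<or> B \<sqsubseteq> z"
          using ent_total[of B "B \<^bold>\<supset> C"] ent_trans[OF and_greatest[OF ent_refl]]
            ent_trans[OF and_greatest[OF _ ent_refl]] by blast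
        then show False using z * ent_trans[OF _ z(1)] by blast
      qed
      then show "\<forall>z. z \<sqsubseteq> y \<longrightarrow> \<not> B \<sqsubseteq> z \<longrightarrow> \<not> C \<sqsubseteq> z" by blast
    qed
    then show ?thesis using IH Imp by simp
  next
    case (Circ B)
    have IH: "forces (\<sqsubseteq>) Atom z B \<longleftrightarrow> \<not> B \<sqsubseteq> z" if "z \<sqsubseteq> y" for z
      using less.IH below[OF that] Circ by simp
    have "(\<forall>z. z \<sqsubseteq> y \<and> \<not> y \<sqsubseteq> z \<longrightarrow> \<not> B \<sqsubseteq> z) \<longleftrightarrow> \<not> Circ B \<sqsubseteq> y"
    proof
      assume *: "\<forall>z. z \<sqsubseteq> y \<and> \<not> y \<sqsubseteq> z \<longrightarrow> \<not> B \<sqsubseteq> z"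
      show "\<not> Circ B \<sqsubseteq> y"
      proof
        assume le: "Circ B \<sqsubseteq> y"
        \<comment> \<open>\<open>B\<close> itself is a world strictly below \<open>y\<close>: it is
          not greatest, yet its successor is at most \<open>y\<close>.\<close>
        then have "B \<sqsubseteq> y" by (rule ent_trans[OF le_suc])
        then have "\<not> Circ B \<sqsubseteq> B" using top_iff below by blast
        then have "\<not> y \<sqsubseteq> B" using ent_trans[OF le] by blast
        then show False using * \<open>B \<sqsubseteq> y\<close> ent_refl by blast
      qed
    next
      assume *: "\<not> Circ B \<sqsubseteq> y"
      show "\<forall>z. z \<sqsubseteq> y \<and> \<not> y \<sqsubseteq> z \<longrightarrow> \<not> B \<sqsubseteq> z"
      proof (intro allI impI notI)
        fix z assume z: "z \<sqsubseteq> y \<and> \<not> y \<sqsubseteq> z" and "B \<sqsubseteq> z"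
        then have "\<not> y \<sqsubseteq> B" using ent_trans[OF _ \<open>B \<sqsubseteq> z\<close>] by blast
        then show False using suc_le * by blast
      qed
    qed
    then show ?thesis using IH Circ by simp
  next
    case (Forall p B)
    obtain m where m: "\<forall>q\<ge>m. q \<notin> vars (Forall p B)" using fin by blast
    have "(\<forall>c. forces (\<sqsubseteq>) (Atom(p := c)) y B) \<longleftrightarrow> (\<forall>q\<ge>m. \<not> subst p (Atom q) B \<sqsubseteq> y)"
    proof
      assume *: "\<forall>c. forces (\<sqsubseteq>) (Atom(p := c)) y B"
      show "\<forall>q\<ge>m. \<not> subst p (Atom q) B \<sqsubseteq> y"
      proof (intro allI impI)
        fix q assume "q \<ge> m"
        then show "\<not> subst p (Atom q) B \<sqsubseteq> y"
          using * bound[of B "Atom q" q p] ent_refl m Forall by simp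
      qed
    next
      assume *: "\<forall>q\<ge>m. \<not> subst p (Atom q) B \<sqsubseteq> y"
      show "\<forall>c. forces (\<sqsubseteq>) (Atom(p := c)) y B"
      proof
        fix c
        obtain q where q: "q \<ge> m" "c \<sqsubseteq> Atom q" "Atom q \<sqsubseteq> c" by (rule name)
        then show "forces (\<sqsubseteq>) (Atom(p := c)) y B" using * bound[OF _ q(2,3), of B p] m Forall by simp
      qed
    qed
    then show ?thesis using Forall_not_le_iff[OF less.prems, of p B m] m Forall by auto
  next
    case (Exists p B)
    obtain m where m: "\<forall>q\<ge>m. q \<notin> vars (Exists p B)" using fin by blast
    have "(\<exists>c. forces (\<sqsubseteq>) (Atom(p := c)) y B) \<longleftrightarrow> (\<exists>q\<ge>m. \<not> subst p (Atom q) B \<sqsubseteq> y)"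
    proof
      assume "\<exists>c. forces (\<sqsubseteq>) (Atom(p := c)) y B"
      then obtain c where c: "forces (\<sqsubseteq>) (Atom(p := c)) y B" by blast
      obtain q where q: "q \<ge> m" "c \<sqsubseteq> Atom q" "Atom q \<sqsubseteq> c" by (rule name)
      then have "\<not> subst p (Atom q) B \<sqsubseteq> y" using c bound[OF _ q(2,3), of B p] m Exists by simp
      then show "\<exists>q\<ge>m. \<not> subst p (Atom q) B \<sqsubseteq> y" using q(1) by blast
    next
      assume "\<exists>q\<ge>m. \<not> subst p (Atom q) B \<sqsubseteq> y"
      then obtain q where "q \<ge> m" "\<not> subst p (Atom q) B \<sqsubseteq> y" by blast
      then have "forces (\<sqsubseteq>) (Atom(p := Atom q)) y B"
        using bound[of B "Atom q" q p] ent_refl m Exists by simp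
      then show "\<exists>c. forces (\<sqsubseteq>) (Atom(p := c)) y B" by blast
    qed
    then show ?thesis using Exists_not_le_iff[of p B y m] m Exists by auto
  qed
qed

end

section \<open>Completeness\<close>

interpretation enat_chain: discrete_chain "(\<le>)" eSuc "0 :: enat"
proof
  fix a b :: enat
  show "a \<le> eSuc a" by (rule ile_eSuc)
  show "\<not> b \<le> a \<Longrightarrow> eSuc a \<le> b" by (simp add: ileI1 not_le)
  show "eSuc a \<le> a \<Longrightarrow> b \<le> a" by (cases a) (auto simp: eSuc_enat)
  show "a \<le> 0 \<or> (\<exists>q. eSuc q \<le> a \<and> a \<le> eSuc q)"
  proof (cases "a = 0")
    case False
    then have "eSuc (a - 1) = a" by (cases a) (auto simp: eSuc_enat one_enat_def zero_enat_def)
    then have "eSuc (a - 1) \<le> a \<and> a \<le> eSuc (a - 1)" by simp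
    then show ?thesis by blast
  qed simp
qed auto

theorem corollary25:
  fixes A :: fm
  assumes "A \<in> Gqp_up"
  shows "\<turnstile> A"
proof (rule ccontr)
  assume "\<not> (\<turnstile> A)"
  then obtain T where "henkin T" "A \<notin> T" by (rule henkin_extension)
  interpret henkin T by fact
  interpret two_chains "\<lambda>B C. (B \<^bold>\<supset> C) \<in> T" Circ Bot "(\<le>)" eSuc "0 :: enat" ..
  have "(eSuc ^^ j) 0 = enat j" for j
    by (induction j) (simp_all add: zero_enat_def eSuc_enat)
  then have "\<not> eSuc ((eSuc ^^ j) 0) \<le> (eSuc ^^ j) 0" for j by (simp add: eSuc_enat)
  then obtain g y where y: "\<not> eSuc y \<le> y"
    and eq: "forces (\<lambda>B C. (B \<^bold>\<supset> C) \<in> T) Atom A A \<longleftrightarrow> forces (\<le>) g y A"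
    using forces_transfer[of A Atom A] \<open>A \<notin> T\<close> top_iff by blast
  have "\<not> forces (\<le>) g y A" using eq truth[OF \<open>A \<notin> T\<close>] ent_refl by blast
  \<comment> \<open>An infinite \<open>y\<close> would be its own successor.\<close>
  moreover obtain n where "y = enat n" using y by (cases y) auto
  ultimately have "\<not> V_enum (enat n) < eval (\<lambda>q. V_enum (g q)) A" using eval_iff_forces by blast
  moreover have "range (\<lambda>q. V_enum (g q)) \<subseteq> V_up" unfolding V_up_eq_range by (rule image_subsetI) simp
  then have "eval (\<lambda>q. V_enum (g q)) A = 1" using assms by (simp add: Gqp_up_def tautology_def)
  ultimately show False using V_enum_less_1 by simp
qed

end
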